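(* Let $0<\varrho<1$ and let $\{\omega_{ij}\}_{i,j\in\mathbb Z_+}$ be independent with $\omega_{00}=0$, $\omega_{i0}\sim\mathrm{Exp}(1-\varrho)$ for $i\ge1$, $\omega_{0j}\sim\mathrm{Exp}(\varrho)$ for $j\ge1$, and $\omega_{ij}\sim\mathrm{Exp}(1)$ for $i,j\ge1$. Let $G^\varrho(t)$ be the last-passage time to the point $(\lfloor(1-\varrho)^2t\rfloor,\lfloor\varrho^2t\rfloor)$. Then \[ 0<\liminf_{t\to\infty}\frac{\mathbf{Var}(G^\varrho(t))}{t^{2/3}}\le\limsup_{t\to\infty}\frac{\mathbf{Var}(G^\varrho(t))}{t^{2/3}}<\infty. \]
   Context: $\mathbb Z_+=\{0,1,2,\dots\}$; $\mathrm{Exp}(r)$ is the exponential distribution with rate $r$ (density $re^{-rx}$, $x\ge 0$). For $(m,n)\in\mathbb Z_+^2$, the last-passage time is $G^\varrho_{mn}=\max_{\pi}\sum_{(p,q)\in\pi}\omega_{pq}$, the maximum over all lattice paths $\pi$ from $(0,0)$ to $(m,n)$ with steps $(1,0)$ and $(0,1)$ (both endpoints included). $G^\varrho(t)=G^\varrho_{mn}$ with $(m,n)=(\lfloor(1-\varrho)^2t\rfloor,\lfloor\varrho^2t\rfloor)$. *)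

theory Defs
  imports "HOL-Probability.Probability"
begin

definition lattice_step :: "nat \<times> nat \<Rightarrow> nat \<times> nat \<Rightarrow> bool" where
  "lattice_step a b \<longleftrightarrow> b = (Suc (fst a), snd a) \<or> b = (fst a, Suc (snd a))"

definition lattice_paths :: "nat \<Rightarrow> nat \<Rightarrow> (nat \<times> nat) list set" where
  "lattice_paths m n =
     {ps. ps \<noteq> [] \<and> hd ps = (0, 0) \<and> last ps = (m, n) \<and> successively lattice_step ps}"

definition last_passage :: "(nat \<times> nat \<Rightarrow> real) \<Rightarrow> nat \<Rightarrow> nat \<Rightarrow> real" where
  "last_passage w m n = (MAX ps\<in>lattice_paths m n. \<Sum>p\<leftarrow>ps. w p)"

text \<open>The maximum above is taken over a finite nonempty set, so \<^const>\<open>Max\<close> is the true maximum.\<close>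

lemma lattice_path_bounds:
  assumes "successively lattice_step ps" "ps \<noteq> []"
  shows "length ps \<le> Suc (fst (last ps) + snd (last ps)) \<and>
         set ps \<subseteq> {..fst (last ps)} \<times> {..snd (last ps)}"
  using assms
proof (induction ps rule: rev_induct)
  case Nil
  then show ?case by simp
next
  case (snoc a ps)
  show ?case
  proof (cases "ps = []")
    case True
    then show ?thesis by (cases a) auto
  next
    case False
    with snoc show ?thesis
      by (cases a; cases "last ps")
        (auto simp: successively_append_iff lattice_step_def)
  qed
qed

lemma finite_lattice_paths: "finite (lattice_paths m n)"
proof (rule finite_subset)
  show "lattice_paths m n \<subseteq> {ps. set ps \<subseteq> {..m} \<times> {..n} \<and> length ps \<le> Suc (m + n)}"
    using lattice_path_bounds by (fastforce simp: lattice_paths_def)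
  show "finite {ps. set ps \<subseteq> {..m} \<times> {..n} \<and> length ps \<le> Suc (m + n)}"
    by (rule finite_lists_length_le) auto
qed

lemma lattice_paths_snoc:
  assumes "ps \<in> lattice_paths i j" "lattice_step (i, j) (m, n)"
  shows "ps @ [(m, n)] \<in> lattice_paths m n"
  using assms by (auto simp: lattice_paths_def successively_append_iff)

lemma lattice_paths_nonempty: "lattice_paths m n \<noteq> {}"
proof -
  have "lattice_paths m 0 \<noteq> {}"
  proof (induction m)
    case 0
    have "[(0, 0)] \<in> lattice_paths 0 0" by (simp add: lattice_paths_def)
    then show ?case by blast
  next
    case (Suc m)
    then show ?case using lattice_paths_snoc[of _ m 0 "Suc m" 0]
      by (auto simp: lattice_step_def)
  qed
  then show ?thesis
  proof (induction n)
    case (Suc n)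
    then show ?case using lattice_paths_snoc[of _ m n m "Suc n"]
      by (auto simp: lattice_step_def)
  qed
qed

definition last_passage_at :: "real \<Rightarrow> (nat \<times> nat \<Rightarrow> 'a \<Rightarrow> real) \<Rightarrow> real \<Rightarrow> 'a \<Rightarrow> real" where
  "last_passage_at \<rho> \<omega> t x =
     last_passage (\<lambda>p. \<omega> p x) (nat \<lfloor>(1 - \<rho>)\<^sup>2 * t\<rfloor>) (nat \<lfloor>\<rho>\<^sup>2 * t\<rfloor>)"

end

theory Submission
  imports Defs
begin

text \<open>
  Write $m \times n$ for the size of the rectangle, $G$ for the last-passage time across it, $W$ for
  the sum of the weights on the left side (the vertical axis), and let $E_{\sigma,\tau}$ be the expectation when the
  bottom weights have rate $1-\sigma$, the left weights rate $\tau$ and the bulk weights rate $1$.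
  The theorem concerns $\sigma = \tau = \varrho$; the other pairs serve as comparison models.

  The engine is an exact formula. For $\sigma = \tau$ the model has the Burke property: the
  increments of $G$ along the top side are distributed like the weights along the bottom side, so
  $G - W$ has the law of the bottom sum. Since $G = W + (G - W)$, an exponential change of measure that
  turns the left rate $\sigma$ into $\tau$ gives
  $E_{\sigma,\tau}\, e^{(\tau-\sigma)G} = (\tau/\sigma)^n ((1-\sigma)/(1-\tau))^m = e^{L(\tau)-L(\sigma)}$
  with $L(x) = n \log x - m \log(1-x)$ (lemma \<open>nn_integral_exp_lpp\<close>).
  At $\varrho$ the first derivative of $L$ is the mean $\mu$ of $G$, the second derivative is
  $m/(1-\varrho)^2 - n/\varrho^2$, which stays bounded along the characteristic direction, and
  the third derivative is of order $t$. Hence $E_{\sigma,\tau}\, e^{(\tau-\sigma)(G-\mu)}$ is of order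
  one as soon as $\sigma$ and $\tau$ are within order $t^{-1/3}$ of $\varrho$.

  For the exponential moments of the stationary model itself, a path uses either bottom
  weights or left weights but never both, so replacing one of the two boundaries cannot affect the paths that
  avoid it: $G$ is at most the maximum of two comparison models with exactly known
  exponential moments (\<open>nn_integral_exp_lpp_le\<close>). Conversely, lowering both boundaries can only
  lower $G$ (\<open>nn_integral_exp_lpp_ge\<close>).

  Upper bound: from $G = W + (G-W)$ and the known variances of both summands,
  $\mathrm{Var}\, G = m/(1-\varrho)^2 - n/\varrho^2 + 2\,\mathrm{Cov}(W,G)$ (\<open>variance_lpp\<close>). Up to
  the factor $\varrho$, the covariance is the derivative of $E\,G$ under stretching of the left weights. As $G$ is a maximum of linear functions
  of the weights, this expectation is convex in the stretching factor, and the derivative is at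
  most a difference quotient (\<open>covariance_left_lpp_le\<close>). With a stretching of relative size
  $t^{-1/3}$ the mean grows by at most order $t^{1/3}$, by the exponential moments above, so the
  covariance is of order $t^{2/3}$.

  Lower bound: with $s$ of order $t^{-1/3}$, comparison with $(\varrho-s, \varrho+s)$ shows that
  $Y = 2s(G-\mu)$ has $E\,e^Y \ge 1 + d$, where $d$ is bounded below because the odd part of $L$
  contains $t s^3$, while $E\,e^{2Y}$ is bounded. Since $e^Y - 1 \le Y e^Y$, the variance of $Y$ cannot be small
  (\<open>variance_lpp_ge\<close>).
\<close>

section \<open>The last-passage recursion\<close>

text \<open>
  The origin contributes nothing here: its weight is $0$ almost surely in the model, and is added
  back in \<open>last_passage_eq_lpp\<close>. Monotonicity, convexity and measurability are then
  inductions along the recursion.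
\<close>

fun lpp :: "(nat \<times> nat \<Rightarrow> real) \<Rightarrow> nat \<Rightarrow> nat \<Rightarrow> real" where
  "lpp x 0 0 = 0"
| "lpp x (Suc i) 0 = x (Suc i, 0) + lpp x i 0"
| "lpp x 0 (Suc j) = x (0, Suc j) + lpp x 0 j"
| "lpp x (Suc i) (Suc j) = x (Suc i, Suc j) + max (lpp x i (Suc j)) (lpp x (Suc i) j)"

definition grid :: "nat \<Rightarrow> nat \<Rightarrow> (nat \<times> nat) set" where
  "grid m n = {..m} \<times> {..n} - {(0, 0)}"

lemma finite_grid [simp]: "finite (grid m n)"
  by (simp add: grid_def)

lemma grid_iff: "(i, j) \<in> grid m n \<longleftrightarrow> i \<le> m \<and> j \<le> n \<and> (0 < i \<or> 0 < j)"
  by (auto simp: grid_def)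

lemma grid_mono: "i \<le> m \<Longrightarrow> j \<le> n \<Longrightarrow> grid i j \<subseteq> grid m n"
  by (auto simp: grid_def)

lemma lattice_path_last:
  assumes "ps \<in> lattice_paths m n" "(m, n) \<noteq> (0, 0)"
  obtains qs i j where "ps = qs @ [(m, n)]" "qs \<in> lattice_paths i j" "lattice_step (i, j) (m, n)"
proof -
  from assms have ps: "ps \<noteq> []" "hd ps = (0, 0)" "last ps = (m, n)" "successively lattice_step ps"
    by (auto simp: lattice_paths_def)
  define qs where "qs = butlast ps"
  have eq: "ps = qs @ [(m, n)]"
    using ps append_butlast_last_id[of ps] by (simp add: qs_def)
  have qs: "qs \<noteq> []"
    using eq ps assms(2) by (cases qs) auto
  obtain i j where ij: "last qs = (i, j)" by (cases "last qs")
  from ps qs ij eq have "qs \<in> lattice_paths i j" "lattice_step (i, j) (m, n)"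
    by (auto simp: lattice_paths_def successively_append_iff)
  with eq that show ?thesis by blast
qed

lemma lattice_paths_rec:
  assumes "(m, n) \<noteq> (0, 0)"
  shows "lattice_paths m n =
    (\<lambda>qs. qs @ [(m, n)]) ` (\<Union>(i, j)\<in>{p. lattice_step p (m, n)}. lattice_paths i j)"
proof (intro equalityI subsetI)
  fix ps assume "ps \<in> lattice_paths m n"
  then obtain qs i j where "ps = qs @ [(m, n)]" "qs \<in> lattice_paths i j" "lattice_step (i, j) (m, n)"
    using assms by (rule lattice_path_last)
  then show "ps \<in> (\<lambda>qs. qs @ [(m, n)]) ` (\<Union>(i, j)\<in>{p. lattice_step p (m, n)}. lattice_paths i j)"
    by (intro image_eqI[where x = qs]) auto
next
  fix ps assume "ps \<in> (\<lambda>qs. qs @ [(m, n)]) ` (\<Union>(i, j)\<in>{p. lattice_step p (m, n)}. lattice_paths i j)"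
  then obtain qs i j where "ps = qs @ [(m, n)]" "qs \<in> lattice_paths i j" "lattice_step (i, j) (m, n)"
    by auto
  then show "ps \<in> lattice_paths m n"
    by (simp add: lattice_paths_snoc)
qed

lemma Max_path_snoc:
  assumes "finite P" "P \<noteq> {}"
  shows "(MAX ps\<in>(\<lambda>qs. qs @ [p]) ` P. \<Sum>p\<leftarrow>ps. (w p :: real)) = w p + (MAX qs\<in>P. \<Sum>p\<leftarrow>qs. w p)"
  using Max_add_commute[OF assms, of "\<lambda>qs. \<Sum>p\<leftarrow>qs. w p" "w p"]
  by (simp add: image_image add.commute)

lemma last_passage_eq_lpp: "last_passage w m n = w (0, 0) + lpp w m n"
proof (induction w m n rule: lpp.induct)
  case (1 w)
  have "ps = [(0, 0)]" if "ps \<in> lattice_paths 0 0" for ps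
    using that lattice_path_bounds[of ps] by (cases ps) (auto simp: lattice_paths_def)
  then have "lattice_paths 0 0 = {[(0, 0)]}"
    by (auto simp: lattice_paths_def)
  then show ?case by (simp add: last_passage_def)
next
  case (2 w i)
  have "{p. lattice_step p (Suc i, 0)} = {(i, 0)}"
    by (auto simp: lattice_step_def)
  then have "lattice_paths (Suc i) 0 = (\<lambda>qs. qs @ [(Suc i, 0)]) ` lattice_paths i 0"
    by (simp add: lattice_paths_rec)
  then show ?case
    using 2 by (simp only: last_passage_def lpp.simps)
      (simp add: Max_path_snoc finite_lattice_paths lattice_paths_nonempty)
next
  case (3 w j)
  have "{p. lattice_step p (0, Suc j)} = {(0, j)}"
    by (auto simp: lattice_step_def)
  then have "lattice_paths 0 (Suc j) = (\<lambda>qs. qs @ [(0, Suc j)]) ` lattice_paths 0 j"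
    by (simp add: lattice_paths_rec)
  then show ?case
    using 3 by (simp only: last_passage_def lpp.simps)
      (simp add: Max_path_snoc finite_lattice_paths lattice_paths_nonempty)
next
  case (4 w i j)
  have "{p. lattice_step p (Suc i, Suc j)} = {(i, Suc j), (Suc i, j)}"
    by (auto simp: lattice_step_def)
  then have "lattice_paths (Suc i) (Suc j) =
      (\<lambda>qs. qs @ [(Suc i, Suc j)]) ` (lattice_paths i (Suc j) \<union> lattice_paths (Suc i) j)"
    by (simp add: lattice_paths_rec)
  then show ?case
    using 4 by (simp only: last_passage_def lpp.simps)
      (simp add: Max_path_snoc finite_lattice_paths lattice_paths_nonempty image_Un Max_Un max_def)
qed

lemma lpp_cong:
  assumes "\<And>p. p \<in> grid m n \<Longrightarrow> x p = y p"
  shows "lpp x m n = lpp y m n"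
  using assms
proof (induction x m n rule: lpp.induct)
  case (4 x i j)
  have "lpp x i (Suc j) = lpp y i (Suc j)" "lpp x (Suc i) j = lpp y (Suc i) j"
    using "4.prems" grid_mono[of i "Suc i" "Suc j" "Suc j"] grid_mono[of "Suc i" "Suc i" j "Suc j"]
    by (intro "4.IH"; auto)+
  then show ?case using "4.prems" by (simp add: grid_iff)
qed (auto simp: grid_iff)

lemma lpp_mono:
  assumes "\<And>p. p \<in> grid m n \<Longrightarrow> x p \<le> y p"
  shows "lpp x m n \<le> lpp y m n"
  using assms
proof (induction x m n rule: lpp.induct)
  case (4 x i j)
  have "lpp x i (Suc j) \<le> lpp y i (Suc j)" "lpp x (Suc i) j \<le> lpp y (Suc i) j"
    using "4.prems" grid_mono[of i "Suc i" "Suc j" "Suc j"] grid_mono[of "Suc i" "Suc i" j "Suc j"]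
    by (intro "4.IH"; auto)+
  then show ?case using "4.prems"[of "(Suc i, Suc j)"] by (auto simp: grid_iff intro!: add_mono max.mono)
qed (auto simp: grid_iff intro!: add_mono)

lemma lpp_zero [simp]: "lpp (\<lambda>p. 0) m n = 0"
  by (induction "\<lambda>p::nat \<times> nat. 0 :: real" m n rule: lpp.induct) auto

lemma lpp_nonneg:
  assumes "\<And>p. p \<in> grid m n \<Longrightarrow> 0 \<le> x p"
  shows "0 \<le> lpp x m n"
  using lpp_mono[of m n "\<lambda>p. 0" x] assms by simp

text \<open>
  The recursion only adds weights and takes maxima, and a maximum of convex functions is convex.
\<close>

lemma lpp_convex:
  assumes "0 \<le> u" "u \<le> 1"
  shows "lpp (\<lambda>p. (1 - u) * x p + u * y p) m n \<le> (1 - u) * lpp x m n + u * lpp y m n"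
proof (induction x m n rule: lpp.induct)
  case (4 x i j)
  have "(1 - u) * max a b + u * max c d \<ge> max ((1 - u) * a + u * c) ((1 - u) * b + u * d)" for a b c d :: real
    using assms by (auto intro!: add_mono mult_left_mono)
  from order_trans[OF max.mono[OF 4] this] show ?case
    by (simp add: algebra_simps)
qed (auto simp: algebra_simps)

text \<open>
  An up-right path leaves the origin along one axis and never meets the other one. Its weight is
  therefore seen in full by \<open>y\<close> (if it avoids the vertical axis) or by \<open>z\<close> (if it avoids the
  horizontal axis).
\<close>

lemma lpp_le_max:
  assumes "\<And>i j. 0 < i \<Longrightarrow> x (i, j) = y (i, j)"
    and "\<And>i j. 0 < j \<Longrightarrow> x (i, j) = z (i, j)"
  shows "lpp x m n \<le> max (lpp y m n) (lpp z m n)"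
  using assms
proof (induction x m n rule: lpp.induct)
  case (2 x i)
  have "lpp x k 0 = lpp y k 0" for k using "2.prems" by (induction k) auto
  then show ?case by (metis max.cobounded1)
next
  case (3 x j)
  have "lpp x 0 k = lpp z 0 k" for k using "3.prems" by (induction k) auto
  then show ?case by (metis max.cobounded2)
next
  case (4 x i j)
  have "x (Suc i, Suc j) = y (Suc i, Suc j)" "x (Suc i, Suc j) = z (Suc i, Suc j)"
    by (rule "4.prems"; simp)+
  with "4.IH"[OF "4.prems"] show ?case by auto
qed auto

lemma measurable_lpp [measurable]:
  "(\<lambda>x. lpp x m n) \<in> borel_measurable (PiM (grid m n) (\<lambda>_. borel))"
proof -
  have "(\<lambda>x. lpp x i j) \<in> borel_measurable (PiM A (\<lambda>_. borel))" if "grid i j \<subseteq> A" for i j A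
    using that
  proof (induction "\<lambda>p::nat\<times>nat. 0::real" i j rule: lpp.induct)
    case (2 i)
    have "grid i 0 \<subseteq> A" using 2 grid_mono[of i "Suc i" 0 0] by auto
    note this[THEN 2(1), measurable]
    have [measurable]: "(\<lambda>x. x (Suc i, 0)) \<in> borel_measurable (PiM A (\<lambda>_. borel :: real measure))"
      by (rule measurable_component_singleton) (use 2 in \<open>auto simp: grid_iff\<close>)
    show ?case by simp
  next
    case (3 j)
    have "grid 0 j \<subseteq> A" using 3 grid_mono[of 0 0 j "Suc j"] by auto
    note this[THEN 3(1), measurable]
    have [measurable]: "(\<lambda>x. x (0, Suc j)) \<in> borel_measurable (PiM A (\<lambda>_. borel :: real measure))"
      by (rule measurable_component_singleton) (use 3 in \<open>auto simp: grid_iff\<close>)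
    show ?case by simp
  next
    case (4 i j)
    have "grid i (Suc j) \<subseteq> A" "grid (Suc i) j \<subseteq> A"
      using 4(3) grid_mono[of i "Suc i" "Suc j" "Suc j"] grid_mono[of "Suc i" "Suc i" j "Suc j"] by auto
    note this(1)[THEN 4(1), measurable] this(2)[THEN 4(2), measurable]
    have [measurable]: "(\<lambda>x. x (Suc i, Suc j)) \<in> borel_measurable (PiM A (\<lambda>_. borel :: real measure))"
      by (rule measurable_component_singleton) (use 4 in \<open>auto simp: grid_iff\<close>)
    show ?case by simp
  qed simp
  then show ?thesis by simp
qed

section \<open>Products of exponential distributions\<close>

definition expo :: "real \<Rightarrow> real measure" where
  "expo r = density lborel (\<lambda>x. ennreal (exponential_density r x))"

definition expo_env :: "'i set \<Rightarrow> ('i \<Rightarrow> real) \<Rightarrow> ('i \<Rightarrow> real) measure" where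
  "expo_env A r = PiM A (\<lambda>p. expo (r p))"

lemma sets_expo [simp, measurable_cong]: "sets (expo r) = sets borel"
  by (simp add: expo_def)

lemma space_expo [simp]: "space (expo r) = UNIV"
  by (simp add: expo_def)

lemma sets_PiM_expo: "sets (PiM A (\<lambda>p. expo (r p))) = sets (PiM A (\<lambda>_. borel))"
  by (rule sets_PiM_cong) auto

lemma sets_expo_env [simp, measurable_cong]:
  "sets (expo_env A r) = sets (PiM A (\<lambda>_. borel))"
  unfolding expo_env_def by (rule sets_PiM_cong) auto

lemma space_expo_env [simp]: "space (expo_env A r) = PiE A (\<lambda>_. UNIV)"
  by (simp add: expo_env_def space_PiM)

lemma prob_space_expo: "0 < r \<Longrightarrow> prob_space (expo r)"
  unfolding expo_def by (rule prob_space_exponential_density)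

lemma sigma_finite_expo: "sigma_finite_measure (expo r)"
  unfolding expo_def
  by (subst sigma_finite_measure.sigma_finite_iff_density_finite[OF sigma_finite_lborel]) auto

lemma product_sigma_finite_expo: "product_sigma_finite (\<lambda>p. expo (r p))"
  by (rule product_sigma_finite.intro) (rule sigma_finite_expo)

lemma prob_space_expo_env: "(\<And>p. p \<in> A \<Longrightarrow> 0 < r p) \<Longrightarrow> prob_space (expo_env A r)"
  unfolding expo_env_def by (intro prob_space_PiM prob_space_expo)

lemma AE_expo_nonneg: "AE x in expo r. 0 \<le> x"
  unfolding expo_def
  by (subst AE_density) (auto intro!: AE_I2 simp: exponential_density_def ennreal_zero_less_mult_iff split: if_splits)

lemma AE_expo_env_nonneg:
  assumes "finite A" "\<And>p. p \<in> A \<Longrightarrow> 0 < r p"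
  shows "AE x in expo_env A r. \<forall>p\<in>A. 0 \<le> x p"
proof (rule AE_finite_allI[OF assms(1)])
  fix p assume "p \<in> A"
  then show "AE x in expo_env A r. 0 \<le> x p"
    unfolding expo_env_def
    by (intro AE_PiM_component prob_space_expo assms AE_expo_nonneg)
qed

lemma expo_eq_density:
  assumes "0 < r" "0 < r'"
  shows "expo r' = density (expo r) (\<lambda>x. ennreal (r' / r * exp ((r - r') * x)))"
  unfolding expo_def using assms
  by (subst density_density_eq)
    (auto intro!: density_cong AE_I2 simp: exponential_density_def ennreal_mult[symmetric] exp_add[symmetric] algebra_simps)

text \<open>
  Two exponential densities have the ratio
  $(r'/r) e^{(r-r')x}$, and the Radon-Nikodym derivative of a finite product is the product of
  the derivatives. This tilting identity is the source of all exact formulas below.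
\<close>

lemma expo_env_eq_density:
  assumes "finite A" and r: "\<And>p. p \<in> A \<Longrightarrow> 0 < r p" "\<And>p. p \<in> A \<Longrightarrow> 0 < r' p"
  shows "expo_env A r' = density (expo_env A r)
      (\<lambda>x. ennreal (\<Prod>p\<in>A. r' p / r p * exp ((r p - r' p) * x p)))"
    (is "_ = density _ ?d")
proof -
  interpret R': product_sigma_finite "\<lambda>p. expo (r' p)" by (rule product_sigma_finite_expo)
  interpret R: product_sigma_finite "\<lambda>p. expo (r p)" by (rule product_sigma_finite_expo)
  have [measurable]: "?d \<in> borel_measurable (PiM A (\<lambda>_. borel))" by measurable
  have "density (expo_env A r) ?d = PiM A (\<lambda>p. expo (r' p))"
  proof (rule R'.PiM_eqI[OF \<open>finite A\<close>])
    show "sets (density (expo_env A r) ?d) = sets (PiM A (\<lambda>p. expo (r' p)))"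
      by (simp add: sets_PiM_expo)
    fix B assume B: "\<And>p. p \<in> A \<Longrightarrow> B p \<in> sets (expo (r' p))"
    let ?f = "\<lambda>p y. ennreal (r' p / r p * exp ((r p - r' p) * y)) * indicator (B p) y"
    have [measurable]: "PiE A B \<in> sets (PiM A (\<lambda>_. borel))"
      using B \<open>finite A\<close> by (auto intro!: sets_PiM_I_finite)
    have "emeasure (density (expo_env A r) ?d) (PiE A B)
        = (\<integral>\<^sup>+x. ?d x * indicator (PiE A B) x \<partial>expo_env A r)"
      by (rule emeasure_density) measurable
    also have "\<dots> = (\<integral>\<^sup>+x. (\<Prod>p\<in>A. ?f p (x p)) \<partial>expo_env A r)"
    proof (rule nn_integral_cong)
      fix x assume x: "x \<in> space (expo_env A r)"
      have "indicator (PiE A B) x = (\<Prod>p\<in>A. indicator (B p) (x p) :: ennreal)"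
        using x \<open>finite A\<close> by (auto simp: indicator_def PiE_iff prod_zero_iff)
      moreover have "?d x = (\<Prod>p\<in>A. ennreal (r' p / r p * exp ((r p - r' p) * x p)))"
        using r by (intro prod_ennreal[symmetric]) (auto intro!: mult_nonneg_nonneg divide_nonneg_nonneg less_imp_le)
      ultimately show "?d x * indicator (PiE A B) x = (\<Prod>p\<in>A. ?f p (x p))"
        by (simp add: prod.distrib)
    qed
    also have "\<dots> = (\<Prod>p\<in>A. integral\<^sup>N (expo (r p)) (?f p))"
      unfolding expo_env_def using B
      by (intro R.product_nn_integral_prod[OF \<open>finite A\<close>]) auto
    also have "\<dots> = (\<Prod>p\<in>A. emeasure (expo (r' p)) (B p))"
    proof (rule prod.cong[OF refl])
      fix p assume p: "p \<in> A"
      have [measurable]: "B p \<in> sets borel" using B[OF p] by simp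
      have "integral\<^sup>N (expo (r p)) (?f p)
        = emeasure (density (expo (r p)) (\<lambda>x. ennreal (r' p / r p * exp ((r p - r' p) * x)))) (B p)"
        by (rule emeasure_density[symmetric]) measurable
      also have "\<dots> = emeasure (expo (r' p)) (B p)"
        using expo_eq_density[OF r(1)[OF p] r(2)[OF p]] by simp
      finally show "integral\<^sup>N (expo (r p)) (?f p) = emeasure (expo (r' p)) (B p)" .
    qed
    finally show "emeasure (density (expo_env A r) ?d) (PiE A B) = (\<Prod>p\<in>A. emeasure (expo (r' p)) (B p))" .
  qed
  then show ?thesis by (simp add: expo_env_def)
qed

lemma distr_expo_scale:
  assumes "0 < c"
  shows "distr (expo r) borel ((*) c) = expo (r / c)"
proof (rule measure_eqI)
  fix X assume "X \<in> sets (distr (expo r) borel ((*) c))"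
  then have [measurable]: "X \<in> sets borel" by simp
  have "emeasure (expo (r / c)) X = (\<integral>\<^sup>+x. ennreal (exponential_density (r / c) x) * indicator X x \<partial>lborel)"
    unfolding expo_def by (subst emeasure_density) auto
  also have "\<dots> = ennreal c * (\<integral>\<^sup>+x. ennreal (exponential_density (r / c) (c * x)) * indicator X (c * x) \<partial>lborel)"
    using assms by (subst nn_integral_real_affine[where c = c and t = 0]) auto
  also have "\<dots> = (\<integral>\<^sup>+x. ennreal c * (ennreal (exponential_density (r / c) (c * x)) * indicator X (c * x)) \<partial>lborel)"
    by (rule nn_integral_cmult[symmetric]) measurable
  also have "\<dots> = (\<integral>\<^sup>+x. ennreal (exponential_density r x) * indicator ((*) c -` X) x \<partial>lborel)"
    using assms by (intro nn_integral_cong)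
      (auto simp: exponential_density_def indicator_def ennreal_mult'[symmetric] mult_less_0_iff)
  also have "\<dots> = emeasure (distr (expo r) borel ((*) c)) X"
    by (subst emeasure_distr) (auto simp: expo_def emeasure_density vimage_def)
  finally show "emeasure (distr (expo r) borel ((*) c)) X = emeasure (expo (r / c)) X" ..
qed simp

text \<open>
  The complementary description of a change of rates: as a rescaling of the same weights, it
  couples environments with different rates on one space.
\<close>

lemma distr_expo_env_scale:
  assumes "finite A" and c: "\<And>p. p \<in> A \<Longrightarrow> 0 < c p"
  shows "distr (expo_env A r) (PiM A (\<lambda>_. borel)) (\<lambda>x. \<lambda>p\<in>A. c p * x p) = expo_env A (\<lambda>p. r p / c p)"
    (is "distr _ _ ?T = _")
proof -
  interpret R': product_sigma_finite "\<lambda>p. expo (r p / c p)" by (rule product_sigma_finite_expo)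
  interpret R: product_sigma_finite "\<lambda>p. expo (r p)" by (rule product_sigma_finite_expo)
  have [measurable]: "?T \<in> measurable (PiM A (\<lambda>_. borel)) (PiM A (\<lambda>_. borel))" by measurable
  have "distr (expo_env A r) (PiM A (\<lambda>_. borel)) ?T = PiM A (\<lambda>p. expo (r p / c p))"
  proof (rule R'.PiM_eqI[OF \<open>finite A\<close>])
    show "sets (distr (expo_env A r) (PiM A (\<lambda>_. borel)) ?T) = sets (PiM A (\<lambda>p. expo (r p / c p)))"
      by (simp add: sets_PiM_expo)
    fix B assume B: "\<And>p. p \<in> A \<Longrightarrow> B p \<in> sets (expo (r p / c p))"
    have B': "(*) (c p) -` B p \<in> sets borel" if "p \<in> A" for p
      using B[OF that] measurable_sets[of "(*) (c p)" borel borel "B p"] by (simp add: vimage_def)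
    have [measurable]: "PiE A B \<in> sets (PiM A (\<lambda>_. borel))"
      using B \<open>finite A\<close> by (auto intro!: sets_PiM_I_finite)
    have "emeasure (distr (expo_env A r) (PiM A (\<lambda>_. borel)) ?T) (PiE A B)
      = emeasure (expo_env A r) (?T -` PiE A B \<inter> space (expo_env A r))"
      by (rule emeasure_distr) measurable
    also have "?T -` PiE A B \<inter> space (expo_env A r) = PiE A (\<lambda>p. (*) (c p) -` B p)"
      by (auto simp: PiE_iff extensional_def)
    also have "emeasure (expo_env A r) \<dots> = (\<Prod>p\<in>A. emeasure (expo (r p)) ((*) (c p) -` B p))"
      unfolding expo_env_def using B' by (intro R.emeasure_PiM \<open>finite A\<close>) auto
    also have "\<dots> = (\<Prod>p\<in>A. emeasure (expo (r p / c p)) (B p))"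
    proof (rule prod.cong[OF refl])
      fix p assume p: "p \<in> A"
      have [measurable]: "B p \<in> sets borel" using B[OF p] by simp
      have "emeasure (expo (r p)) ((*) (c p) -` B p) = emeasure (distr (expo (r p)) borel ((*) (c p))) (B p)"
        by (subst emeasure_distr) auto
      also have "\<dots> = emeasure (expo (r p / c p)) (B p)"
        by (simp only: distr_expo_scale[OF c[OF p]])
      finally show "emeasure (expo (r p)) ((*) (c p) -` B p) = emeasure (expo (r p / c p)) (B p)" .
    qed
    finally show "emeasure (distr (expo_env A r) (PiM A (\<lambda>_. borel)) ?T) (PiE A B)
      = (\<Prod>p\<in>A. emeasure (expo (r p / c p)) (B p))" .
  qed
  then show ?thesis by (simp add: expo_env_def)
qed

section \<open>The Burke property\<close>

text \<open>
  The map $(i,j,w) \mapsto (w + (i-j)^+, w + (j-i)^+, \min(i,j))$ is an involution of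
  $\mathbb{R}^3$ that preserves volume. On each of the regions $i \ge j$ and $i < j$ the coordinate
  $u = |i-j|$ is kept, and the map merely exchanges $w$ with $\min(i,j)$.
\<close>

lemma nn_integral_burke_lborel:
  fixes h :: "real \<times> real \<times> real \<Rightarrow> ennreal"
  assumes [measurable]: "h \<in> borel_measurable borel"
  shows "(\<integral>\<^sup>+i. \<integral>\<^sup>+j. \<integral>\<^sup>+w. h (w + max (i - j) 0, w + max (j - i) 0, min i j) \<partial>lborel \<partial>lborel \<partial>lborel)
    = (\<integral>\<^sup>+i. \<integral>\<^sup>+j. \<integral>\<^sup>+w. h (i, j, w) \<partial>lborel \<partial>lborel \<partial>lborel)"
proof -
  let ?L = "lborel :: real measure"
  have split: "(\<integral>\<^sup>+i. \<integral>\<^sup>+j. \<integral>\<^sup>+w. g (i, j, w) \<partial>?L \<partial>?L \<partial>?L) =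
      (\<integral>\<^sup>+j. \<integral>\<^sup>+u. \<integral>\<^sup>+w. g (j + u, j, w) * indicator {0..} u \<partial>?L \<partial>?L \<partial>?L)
    + (\<integral>\<^sup>+i. \<integral>\<^sup>+u. \<integral>\<^sup>+w. g (i, i + u, w) * indicator {0<..} u \<partial>?L \<partial>?L \<partial>?L)"
    if [measurable]: "g \<in> borel_measurable borel" for g :: "real \<times> real \<times> real \<Rightarrow> ennreal"
  proof -
    have "(\<integral>\<^sup>+i. \<integral>\<^sup>+j. \<integral>\<^sup>+w. g (i, j, w) \<partial>?L \<partial>?L \<partial>?L) =
        (\<integral>\<^sup>+i. \<integral>\<^sup>+j. \<integral>\<^sup>+w. g (i, j, w) * indicator {0..} (i - j) + g (i, j, w) * indicator {0<..} (j - i) \<partial>?L \<partial>?L \<partial>?L)"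
      by (intro nn_integral_cong) (auto simp: indicator_def)
    also have "\<dots> = (\<integral>\<^sup>+i. \<integral>\<^sup>+j. \<integral>\<^sup>+w. g (i, j, w) * indicator {0..} (i - j) \<partial>?L \<partial>?L \<partial>?L)
        + (\<integral>\<^sup>+i. \<integral>\<^sup>+j. \<integral>\<^sup>+w. g (i, j, w) * indicator {0<..} (j - i) \<partial>?L \<partial>?L \<partial>?L)"
      by (simp add: nn_integral_add)
    also have "(\<integral>\<^sup>+i. \<integral>\<^sup>+j. \<integral>\<^sup>+w. g (i, j, w) * indicator {0..} (i - j) \<partial>?L \<partial>?L \<partial>?L)
        = (\<integral>\<^sup>+j. \<integral>\<^sup>+i. \<integral>\<^sup>+w. g (i, j, w) * indicator {0..} (i - j) \<partial>?L \<partial>?L \<partial>?L)"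
      by (rule lborel_pair.Fubini') measurable
    also have "\<dots> = (\<integral>\<^sup>+j. \<integral>\<^sup>+u. \<integral>\<^sup>+w. g (j + u, j, w) * indicator {0..} u \<partial>?L \<partial>?L \<partial>?L)"
    proof (rule nn_integral_cong)
      fix j :: real
      show "(\<integral>\<^sup>+i. \<integral>\<^sup>+w. g (i, j, w) * indicator {0..} (i - j) \<partial>?L \<partial>?L)
        = (\<integral>\<^sup>+u. \<integral>\<^sup>+w. g (j + u, j, w) * indicator {0..} u \<partial>?L \<partial>?L)"
        using nn_integral_real_affine[of "\<lambda>i. \<integral>\<^sup>+w. g (i, j, w) * indicator {0..} (i - j) \<partial>?L" 1 j]
        by simp
    qed
    also have "(\<integral>\<^sup>+i. \<integral>\<^sup>+j. \<integral>\<^sup>+w. g (i, j, w) * indicator {0<..} (j - i) \<partial>?L \<partial>?L \<partial>?L)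
       = (\<integral>\<^sup>+i. \<integral>\<^sup>+u. \<integral>\<^sup>+w. g (i, i + u, w) * indicator {0<..} u \<partial>?L \<partial>?L \<partial>?L)"
    proof (rule nn_integral_cong)
      fix i :: real
      show "(\<integral>\<^sup>+j. \<integral>\<^sup>+w. g (i, j, w) * indicator {0<..} (j - i) \<partial>?L \<partial>?L)
        = (\<integral>\<^sup>+u. \<integral>\<^sup>+w. g (i, i + u, w) * indicator {0<..} u \<partial>?L \<partial>?L)"
        using nn_integral_real_affine[of "\<lambda>j. \<integral>\<^sup>+w. g (i, j, w) * indicator {0<..} (j - i) \<partial>?L" 1 i]
        by simp
    qed
    finally show ?thesis .
  qed
  have swap: "(\<integral>\<^sup>+a. \<integral>\<^sup>+u. \<integral>\<^sup>+b. k (a, u, b) \<partial>?L \<partial>?L \<partial>?L) = (\<integral>\<^sup>+a. \<integral>\<^sup>+u. \<integral>\<^sup>+b. k (b, u, a) \<partial>?L \<partial>?L \<partial>?L)"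
    if [measurable]: "k \<in> borel_measurable borel" for k :: "real \<times> real \<times> real \<Rightarrow> ennreal"
  proof -
    have "(\<integral>\<^sup>+a. \<integral>\<^sup>+u. \<integral>\<^sup>+b. k (a, u, b) \<partial>?L \<partial>?L \<partial>?L) = (\<integral>\<^sup>+u. \<integral>\<^sup>+a. \<integral>\<^sup>+b. k (a, u, b) \<partial>?L \<partial>?L \<partial>?L)"
      by (rule lborel_pair.Fubini') measurable
    also have "\<dots> = (\<integral>\<^sup>+u. \<integral>\<^sup>+b. \<integral>\<^sup>+a. k (a, u, b) \<partial>?L \<partial>?L \<partial>?L)"
      by (intro nn_integral_cong lborel_pair.Fubini') measurable
    also have "\<dots> = (\<integral>\<^sup>+b. \<integral>\<^sup>+u. \<integral>\<^sup>+a. k (a, u, b) \<partial>?L \<partial>?L \<partial>?L)"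
      by (rule lborel_pair.Fubini') measurable
    finally show ?thesis .
  qed
  have [measurable]: "(\<lambda>(i, j, w). h (w + max (i - j) 0, w + max (j - i) 0, min i j)) \<in> borel_measurable borel"
    by (simp only: case_prod_beta borel_prod[symmetric]) measurable
  have [measurable]: "(\<lambda>(j, u, w). h (w + u, w, j) * indicator {0..} u) \<in> borel_measurable borel"
    by (simp only: case_prod_beta borel_prod[symmetric]) measurable
  have [measurable]: "(\<lambda>(j, u, w). h (w, w + u, j) * indicator {0<..} u) \<in> borel_measurable borel"
    by (simp only: case_prod_beta borel_prod[symmetric]) measurable
  have "(\<integral>\<^sup>+i. \<integral>\<^sup>+j. \<integral>\<^sup>+w. h (w + max (i - j) 0, w + max (j - i) 0, min i j) \<partial>?L \<partial>?L \<partial>?L)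
    = (\<integral>\<^sup>+j. \<integral>\<^sup>+u. \<integral>\<^sup>+w. h (w + max u 0, w + max (- u) 0, min (j + u) j) * indicator {0..} u \<partial>?L \<partial>?L \<partial>?L)
    + (\<integral>\<^sup>+i. \<integral>\<^sup>+u. \<integral>\<^sup>+w. h (w + max (- u) 0, w + max u 0, min i (i + u)) * indicator {0<..} u \<partial>?L \<partial>?L \<partial>?L)"
    by (subst split[of "\<lambda>(i, j, w). h (w + max (i - j) 0, w + max (j - i) 0, min i j)", simplified]) auto
  also have "\<dots> = (\<integral>\<^sup>+j. \<integral>\<^sup>+u. \<integral>\<^sup>+w. h (w + u, w, j) * indicator {0..} u \<partial>?L \<partial>?L \<partial>?L)
    + (\<integral>\<^sup>+i. \<integral>\<^sup>+u. \<integral>\<^sup>+w. h (w, w + u, i) * indicator {0<..} u \<partial>?L \<partial>?L \<partial>?L)"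
    by (intro arg_cong2[where f = "(+)"] nn_integral_cong) (auto simp: indicator_def)
  also have "(\<integral>\<^sup>+j. \<integral>\<^sup>+u. \<integral>\<^sup>+w. h (w + u, w, j) * indicator {0..} u \<partial>?L \<partial>?L \<partial>?L)
    = (\<integral>\<^sup>+j. \<integral>\<^sup>+u. \<integral>\<^sup>+w. h (j + u, j, w) * indicator {0..} u \<partial>?L \<partial>?L \<partial>?L)"
    by (subst swap[of "\<lambda>(j, u, w). h (w + u, w, j) * indicator {0..} u", simplified]) auto
  also have "(\<integral>\<^sup>+i. \<integral>\<^sup>+u. \<integral>\<^sup>+w. h (w, w + u, i) * indicator {0<..} u \<partial>?L \<partial>?L \<partial>?L)
    = (\<integral>\<^sup>+i. \<integral>\<^sup>+u. \<integral>\<^sup>+w. h (i, i + u, w) * indicator {0<..} u \<partial>?L \<partial>?L \<partial>?L)"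
    by (subst swap[of "\<lambda>(j, u, w). h (w, w + u, j) * indicator {0<..} u", simplified]) auto
  also have "(\<integral>\<^sup>+j. \<integral>\<^sup>+u. \<integral>\<^sup>+w. h (j + u, j, w) * indicator {0..} u \<partial>?L \<partial>?L \<partial>?L)
    + (\<integral>\<^sup>+i. \<integral>\<^sup>+u. \<integral>\<^sup>+w. h (i, i + u, w) * indicator {0<..} u \<partial>?L \<partial>?L \<partial>?L)
    = (\<integral>\<^sup>+i. \<integral>\<^sup>+j. \<integral>\<^sup>+w. h (i, j, w) \<partial>?L \<partial>?L \<partial>?L)"
    by (rule split[symmetric]) simp
  finally show ?thesis .
qed

lemma nn_integral_expo:
  assumes [measurable]: "f \<in> borel_measurable borel"
  shows "(\<integral>\<^sup>+x. f x \<partial>expo r) = (\<integral>\<^sup>+x. ennreal (exponential_density r x) * f x \<partial>lborel)"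
  unfolding expo_def by (rule nn_integral_density) auto

text \<open>
  Writing $i', j'$ for the images of $i, j$, the exponent is invariant because
  $i' = w + i - \min(i,j)$ and $j' = w + j - \min(i,j)$; the rate of $w$ has to be $a + b$ for
  the two minima to cancel. The supports agree because $\min(i',j') = w$.
\<close>

lemma exponential_density_burke:
  assumes "0 < a" "0 < b"
  shows "exponential_density a (w + max (i - j) 0) * exponential_density b (w + max (j - i) 0) *
      exponential_density (a + b) (min i j) =
    exponential_density a i * exponential_density b j * exponential_density (a + b) w"
proof (cases "w < 0 \<or> i < 0 \<or> j < 0")
  case True
  then show ?thesis by (auto simp: exponential_density_def max_def min_def)
next
  case False
  have "exponential_density a (w + max (i - j) 0) * exponential_density b (w + max (j - i) 0) *
      exponential_density (a + b) (min i j) = a * b * (a + b) *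
      exp (- (w + max (i - j) 0) * a + - (w + max (j - i) 0) * b + - min i j * (a + b))"
  proof -
    have "\<not> w + max (i - j) 0 < 0" "\<not> w + max (j - i) 0 < 0" "\<not> min i j < 0"
      using False by auto
    then show ?thesis by (simp only: exponential_density_def exp_add if_False) simp
  qed
  also have "- (w + max (i - j) 0) * a + - (w + max (j - i) 0) * b + - min i j * (a + b)
      = - i * a + - j * b + - w * (a + b)"
    by (auto simp: max_def min_def algebra_simps)
  also have "a * b * (a + b) * exp \<dots> =
    exponential_density a i * exponential_density b j * exponential_density (a + b) w"
  proof -
    have "\<not> w < 0" "\<not> i < 0" "\<not> j < 0"
      using False by auto
    then show ?thesis by (simp only: exponential_density_def exp_add if_False) simp
  qed
  finally show ?thesis .
qed

lemma nn_integral_burke_expo: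
  fixes g :: "real \<times> real \<times> real \<Rightarrow> ennreal"
  assumes [measurable]: "g \<in> borel_measurable borel" and ab: "0 < a" "0 < b"
  shows "(\<integral>\<^sup>+i. \<integral>\<^sup>+j. \<integral>\<^sup>+w. g (w + max (i - j) 0, w + max (j - i) 0, min i j) \<partial>expo (a + b) \<partial>expo b \<partial>expo a)
    = (\<integral>\<^sup>+i. \<integral>\<^sup>+j. \<integral>\<^sup>+w. g (i, j, w) \<partial>expo (a + b) \<partial>expo b \<partial>expo a)"
proof -
  define d where "d i j w = ennreal (exponential_density a i * exponential_density b j * exponential_density (a + b) w)"
    for i j w
  have [measurable]: "(\<lambda>(i, j, w). d i j w) \<in> borel_measurable borel"
    unfolding d_def borel_prod[symmetric] by measurable
  have d_split: "d i j w = ennreal (exponential_density a i) * (ennreal (exponential_density b j) *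
      ennreal (exponential_density (a + b) w))" for i j w
    using ab by (simp add: d_def ennreal_mult' mult.assoc)
  have eq: "(\<integral>\<^sup>+i. \<integral>\<^sup>+j. \<integral>\<^sup>+w. k (i, j, w) \<partial>expo (a + b) \<partial>expo b \<partial>expo a)
      = (\<integral>\<^sup>+i. \<integral>\<^sup>+j. \<integral>\<^sup>+w. d i j w * k (i, j, w) \<partial>lborel \<partial>lborel \<partial>lborel)"
    if [measurable]: "k \<in> borel_measurable borel" for k :: "real \<times> real \<times> real \<Rightarrow> ennreal"
    by (simp add: nn_integral_expo d_split nn_integral_cmult[symmetric] mult.assoc)
  have [measurable]: "(\<lambda>(i, j, w). g (w + max (i - j) 0, w + max (j - i) 0, min i j)) \<in> borel_measurable borel"
    by (simp only: case_prod_beta borel_prod[symmetric]) measurable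
  have "(\<integral>\<^sup>+i. \<integral>\<^sup>+j. \<integral>\<^sup>+w. g (w + max (i - j) 0, w + max (j - i) 0, min i j) \<partial>expo (a + b) \<partial>expo b \<partial>expo a)
    = (\<integral>\<^sup>+i. \<integral>\<^sup>+j. \<integral>\<^sup>+w. d i j w * g (w + max (i - j) 0, w + max (j - i) 0, min i j) \<partial>lborel \<partial>lborel \<partial>lborel)"
    by (subst eq[of "\<lambda>(i, j, w). g (w + max (i - j) 0, w + max (j - i) 0, min i j)", simplified]) auto
  also have "\<dots> = (\<integral>\<^sup>+i. \<integral>\<^sup>+j. \<integral>\<^sup>+w. (\<lambda>(i, j, w). d i j w * g (i, j, w))
      (w + max (i - j) 0, w + max (j - i) 0, min i j) \<partial>lborel \<partial>lborel \<partial>lborel)"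
    using exponential_density_burke[OF ab] by (simp add: d_def)
  also have "\<dots> = (\<integral>\<^sup>+i. \<integral>\<^sup>+j. \<integral>\<^sup>+w. (\<lambda>(i, j, w). d i j w * g (i, j, w)) (i, j, w) \<partial>lborel \<partial>lborel \<partial>lborel)"
  proof (rule nn_integral_burke_lborel)
    have "(\<lambda>p. (\<lambda>(i, j, w). d i j w) p * g p) \<in> borel_measurable borel" by measurable
    also have "(\<lambda>p. (\<lambda>(i, j, w). d i j w) p * g p) = (\<lambda>(i, j, w). d i j w * g (i, j, w))"
      by auto
    finally show "(\<lambda>(i, j, w). d i j w * g (i, j, w)) \<in> borel_measurable borel" .
  qed
  also have "\<dots> = (\<integral>\<^sup>+i. \<integral>\<^sup>+j. \<integral>\<^sup>+w. g (i, j, w) \<partial>expo (a + b) \<partial>expo b \<partial>expo a)"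
    by (subst eq) auto
  finally show ?thesis .
qed

text \<open>
  One step of the last-passage recursion in increments. If \<open>a\<close> carries the horizontal increment on
  the bottom side and \<open>b\<close> the vertical increment on the left side of a unit square with weight at \<open>c\<close>,
  then after the step they carry the increments on its top and right sides. Storing the minimum in
  place of the consumed weight makes the step an involution, which can preserve the law of the whole
  environment instead of only that of the two increments.
\<close>

definition flip :: "'i \<Rightarrow> 'i \<Rightarrow> 'i \<Rightarrow> ('i \<Rightarrow> real) \<Rightarrow> 'i \<Rightarrow> real" where
  "flip a b c x = x(a := x c + max (x a - x b) 0, b := x c + max (x b - x a) 0, c := min (x a) (x b))"

lemma measurable_flip:
  assumes "a \<in> A" "b \<in> A" "c \<in> A"
  shows "flip a b c \<in> measurable (PiM A (\<lambda>_. borel)) (PiM A (\<lambda>_. borel))"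
proof -
  have [measurable]: "(\<lambda>x. x p) \<in> borel_measurable (PiM A (\<lambda>_. borel :: real measure))" if "p \<in> {a, b, c}" for p
    by (rule measurable_component_singleton) (use assms that in auto)
  have "insert p A = A" if "p \<in> {a, b, c}" for p using assms that by auto
  then show ?thesis
    unfolding flip_def
    by (intro measurable_fun_upd[where J = A]) (auto simp: sup_commute insert_absorb)
qed

lemma distr_flip:
  assumes "finite A" and abc: "a \<in> A" "b \<in> A" "c \<in> A" "a \<noteq> b" "a \<noteq> c" "b \<noteq> c"
    and r: "0 < r a" "0 < r b" "r c = r a + r b"
  shows "distr (expo_env A r) (PiM A (\<lambda>_. borel)) (flip a b c) = expo_env A r"
proof (rule measure_eqI)
  interpret product_sigma_finite "\<lambda>p. expo (r p)" by (rule product_sigma_finite_expo)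
  define B where "B = A - {a, b, c}"
  have A: "A = insert c (insert b (insert a B))" and B: "finite B" "a \<notin> B" "b \<notin> insert a B" "c \<notin> insert b (insert a B)"
    using assms by (auto simp: B_def)
  have [measurable]: "flip a b c \<in> measurable (PiM A (\<lambda>_. borel)) (PiM A (\<lambda>_. borel))"
    by (rule measurable_flip) fact+
  have expand: "(\<integral>\<^sup>+x. f x \<partial>expo_env A r) = (\<integral>\<^sup>+x. \<integral>\<^sup>+i. \<integral>\<^sup>+j. \<integral>\<^sup>+w. f (x(a := i, b := j, c := w))
      \<partial>expo (r c) \<partial>expo (r b) \<partial>expo (r a) \<partial>PiM B (\<lambda>p. expo (r p)))"
    if f: "f \<in> borel_measurable (PiM A (\<lambda>_. borel))" for f
  proof -
    have s: "sets (PiM C (\<lambda>p. expo (r p))) = sets (PiM C (\<lambda>_. borel))" for C by (rule sets_PiM_expo)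
    note [measurable_cong] = s
    have f1: "f \<in> borel_measurable (PiM (insert c (insert b (insert a B))) (\<lambda>p. expo (r p)))"
      using f by (simp add: A s cong: measurable_cong_sets)
    have step: "(\<lambda>x. \<integral>\<^sup>+w. g (x(p := w)) \<partial>expo (r p)) \<in> borel_measurable (PiM C (\<lambda>p. expo (r p)))"
      if "g \<in> borel_measurable (PiM (insert p C) (\<lambda>p. expo (r p)))" for g :: "('a \<Rightarrow> real) \<Rightarrow> ennreal" and p C
      using measurable_compose[OF measurable_add_dim that]
      by (intro sigma_finite_measure.borel_measurable_nn_integral[OF sigma_finite_expo]) (simp add: case_prod_beta)
    have f2: "(\<lambda>x. \<integral>\<^sup>+w. f (x(c := w)) \<partial>expo (r c)) \<in> borel_measurable (PiM (insert b (insert a B)) (\<lambda>p. expo (r p)))"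
      using f1 by (rule step)
    have f3: "(\<lambda>x. \<integral>\<^sup>+j. \<integral>\<^sup>+w. f (x(b := j, c := w)) \<partial>expo (r c) \<partial>expo (r b)) \<in> borel_measurable (PiM (insert a B) (\<lambda>p. expo (r p)))"
      using f2 by (rule step)
    show ?thesis
      unfolding expo_env_def A
      by (subst product_nn_integral_insert[OF _ B(4) f1], use B in simp,
          subst product_nn_integral_insert[OF _ B(3) f2], use B in simp,
          subst product_nn_integral_insert[OF _ B(2) f3], use B in auto)
  qed
  fix X assume "X \<in> sets (distr (expo_env A r) (PiM A (\<lambda>_. borel)) (flip a b c))"
  then have [measurable]: "X \<in> sets (PiM A (\<lambda>_. borel))" by simp
  have "emeasure (distr (expo_env A r) (PiM A (\<lambda>_. borel)) (flip a b c)) X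
      = (\<integral>\<^sup>+y. indicator X y \<partial>distr (expo_env A r) (PiM A (\<lambda>_. borel)) (flip a b c))"
    by simp
  also have "\<dots> = (\<integral>\<^sup>+x. indicator X (flip a b c x) \<partial>expo_env A r)"
    by (rule nn_integral_distr) measurable
  also have "\<dots> = (\<integral>\<^sup>+x. \<integral>\<^sup>+i. \<integral>\<^sup>+j. \<integral>\<^sup>+w. indicator X (flip a b c (x(a := i, b := j, c := w)))
      \<partial>expo (r c) \<partial>expo (r b) \<partial>expo (r a) \<partial>PiM B (\<lambda>p. expo (r p)))"
    by (rule expand) measurable
  also have "\<dots> = (\<integral>\<^sup>+x. \<integral>\<^sup>+i. \<integral>\<^sup>+j. \<integral>\<^sup>+w. indicator X (x(a := i, b := j, c := w))
      \<partial>expo (r c) \<partial>expo (r b) \<partial>expo (r a) \<partial>PiM B (\<lambda>p. expo (r p)))"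
  proof (rule nn_integral_cong)
    fix x assume x: "x \<in> space (PiM B (\<lambda>p. expo (r p)))"
    define g :: "real \<times> real \<times> real \<Rightarrow> ennreal" where "g = (\<lambda>(i, j, w). indicator X (x(a := i, b := j, c := w)))"
    have "(\<lambda>(i, j, w). x(a := i, b := j, c := w)) \<in> measurable borel (PiM A (\<lambda>_. borel))"
    proof -
      have upd: "(\<lambda>p. (f p)(q := h p)) \<in> measurable N (PiM (insert q J) (\<lambda>_. borel))"
        if "f \<in> measurable N (PiM J (\<lambda>_. borel))" "h \<in> borel_measurable N"
        for f h q J and N :: "(real \<times> real \<times> real) measure"
        using that by (intro measurable_fun_upd[where J = J]) auto
      let ?N = "borel \<Otimes>\<^sub>M (borel \<Otimes>\<^sub>M borel) :: (real \<times> real \<times> real) measure"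
      have "(\<lambda>p. x) \<in> measurable ?N (PiM B (\<lambda>_. borel))" using x by (simp add: space_PiM)
      moreover have "fst \<in> borel_measurable ?N" "(\<lambda>p. fst (snd p)) \<in> borel_measurable ?N"
        "(\<lambda>p. snd (snd p)) \<in> borel_measurable ?N"
        by measurable
      ultimately have "(\<lambda>p. x(a := fst p, b := fst (snd p), c := snd (snd p))) \<in> measurable ?N (PiM A (\<lambda>_. borel))"
        unfolding A by (intro upd)
      then show ?thesis by (simp add: case_prod_beta borel_prod)
    qed
    from measurable_compose[OF this, of "indicator X" "borel :: ennreal measure"]
    have gm: "g \<in> borel_measurable borel"
      by (simp add: g_def case_prod_beta)
    show "(\<integral>\<^sup>+i. \<integral>\<^sup>+j. \<integral>\<^sup>+w. indicator X (flip a b c (x(a := i, b := j, c := w)))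
        \<partial>expo (r c) \<partial>expo (r b) \<partial>expo (r a))
      = (\<integral>\<^sup>+i. \<integral>\<^sup>+j. \<integral>\<^sup>+w. indicator X (x(a := i, b := j, c := w))
        \<partial>expo (r c) \<partial>expo (r b) \<partial>expo (r a))"
      using nn_integral_burke_expo[OF gm r(1,2)] abc(4-6)
      by (simp add: g_def flip_def r(3) fun_upd_twist)
  qed
  also have "\<dots> = (\<integral>\<^sup>+x. indicator X x \<partial>expo_env A r)"
    by (rule expand[symmetric]) measurable
  also have "\<dots> = emeasure (expo_env A r) X" by simp
  finally show "emeasure (distr (expo_env A r) (PiM A (\<lambda>_. borel)) (flip a b c)) X = emeasure (expo_env A r) X" .
qed simp

text \<open>
  Processing row \<open>j\<close> square by square overwrites the horizontal increments at height $j-1$, kept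
  at \<open>(i, 0)\<close>, by those at height $j$, while \<open>(0, j)\<close> carries the current vertical increment.
\<close>

fun sweep_row :: "nat \<Rightarrow> nat \<Rightarrow> (nat \<times> nat \<Rightarrow> real) \<Rightarrow> nat \<times> nat \<Rightarrow> real" where
  "sweep_row 0 j x = x"
| "sweep_row (Suc k) j x = flip (Suc k, 0) (0, j) (Suc k, j) (sweep_row k j x)"

fun sweep :: "nat \<Rightarrow> nat \<Rightarrow> (nat \<times> nat \<Rightarrow> real) \<Rightarrow> nat \<times> nat \<Rightarrow> real" where
  "sweep m 0 x = x"
| "sweep m (Suc n) x = sweep_row m (Suc n) (sweep m n x)"

lemma sweep_row_lpp:
  assumes y: "\<And>i. i < m \<Longrightarrow> y (Suc i, 0) = lpp x (Suc i) n - lpp x i n"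
    "\<And>i j. n < j \<Longrightarrow> y (i, j) = x (i, j)" and "k \<le> m"
  shows "(\<forall>i<k. sweep_row k (Suc n) y (Suc i, 0) = lpp x (Suc i) (Suc n) - lpp x i (Suc n)) \<and>
    (\<forall>i\<ge>k. sweep_row k (Suc n) y (Suc i, 0) = y (Suc i, 0)) \<and>
    sweep_row k (Suc n) y (0, Suc n) = lpp x k (Suc n) - lpp x k n \<and>
    (\<forall>i>k. sweep_row k (Suc n) y (i, Suc n) = x (i, Suc n)) \<and>
    (\<forall>i. \<forall>j>Suc n. sweep_row k (Suc n) y (i, j) = x (i, j))"
  using \<open>k \<le> m\<close>
proof (induction k)
  case 0
  then show ?case using y by auto
next
  case (Suc k)
  then show ?case using y(1)[of k]
    by (auto simp: flip_def less_Suc_eq max_def)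
qed

lemma sweep_lpp:
  "(\<forall>i<m. sweep m n x (Suc i, 0) = lpp x (Suc i) n - lpp x i n) \<and>
   (\<forall>i. \<forall>j>n. sweep m n x (i, j) = x (i, j))"
proof (induction n)
  case 0
  then show ?case by simp
next
  case (Suc n)
  then show ?case using sweep_row_lpp[of m "sweep m n x" x n m] by simp
qed

definition bottom_sum :: "nat \<Rightarrow> (nat \<times> nat \<Rightarrow> real) \<Rightarrow> real" where
  "bottom_sum m x = (\<Sum>i<m. x (Suc i, 0))"

definition left_sum :: "nat \<Rightarrow> (nat \<times> nat \<Rightarrow> real) \<Rightarrow> real" where
  "left_sum n x = (\<Sum>j<n. x (0, Suc j))"

text \<open>
  After all rows have been processed, the bottom entries are the increments of the last-passage
  time along the top side, and these telescope.
\<close>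

lemma bottom_sum_sweep: "bottom_sum m (sweep m n x) = lpp x m n - left_sum n x"
proof -
  have "bottom_sum m (sweep m n x) = (\<Sum>i<m. lpp x (Suc i) n - lpp x i n)"
    unfolding bottom_sum_def using sweep_lpp[of m n x] by (intro sum.cong) auto
  also have "\<dots> = lpp x m n - lpp x 0 n"
    by (rule sum_lessThan_telescope)
  also have "lpp x 0 n = left_sum n x"
    unfolding left_sum_def by (induction n) auto
  finally show ?thesis .
qed

text \<open>
  The bottom side is parametrised by \<open>1 - \<sigma>\<close>, so that the rates of the two axes add up to the bulk
  rate, as the Burke property requires, precisely for \<open>\<sigma> = \<tau>\<close>.
\<close>

definition rates :: "real \<Rightarrow> real \<Rightarrow> nat \<times> nat \<Rightarrow> real" where
  "rates \<sigma> \<tau> p = (if snd p = 0 then 1 - \<sigma> else if fst p = 0 then \<tau> else 1)"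

definition lpp_env :: "nat \<Rightarrow> nat \<Rightarrow> real \<Rightarrow> real \<Rightarrow> (nat \<times> nat \<Rightarrow> real) measure" where
  "lpp_env m n \<sigma> \<tau> = expo_env (grid m n) (rates \<sigma> \<tau>)"

lemma sweep_row_measure_preserving:
  assumes "0 < \<sigma>" "\<sigma> < 1" "k \<le> m" "0 < j" "j \<le> n"
  shows "sweep_row k j \<in> measurable (PiM (grid m n) (\<lambda>_. borel)) (PiM (grid m n) (\<lambda>_. borel)) \<and>
    distr (lpp_env m n \<sigma> \<sigma>) (PiM (grid m n) (\<lambda>_. borel)) (sweep_row k j) = lpp_env m n \<sigma> \<sigma>"
  using \<open>k \<le> m\<close>
proof (induction k)
  case 0
  have "sweep_row 0 j = (\<lambda>x. x)" by auto
  then show ?case by (simp add: lpp_env_def distr_id2)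
next
  case (Suc k)
  let ?f = "flip (Suc k, 0) (0, j) (Suc k, j)"
  have eq: "sweep_row (Suc k) j = ?f \<circ> sweep_row k j" by auto
  have f: "?f \<in> measurable (PiM (grid m n) (\<lambda>_. borel)) (PiM (grid m n) (\<lambda>_. borel))"
    using Suc.prems assms by (intro measurable_flip) (auto simp: grid_iff)
  have s: "sweep_row k j \<in> measurable (PiM (grid m n) (\<lambda>_. borel)) (PiM (grid m n) (\<lambda>_. borel))"
    and d: "distr (lpp_env m n \<sigma> \<sigma>) (PiM (grid m n) (\<lambda>_. borel)) (sweep_row k j) = lpp_env m n \<sigma> \<sigma>"
    using Suc by auto
  have s': "sweep_row k j \<in> measurable (lpp_env m n \<sigma> \<sigma>) (PiM (grid m n) (\<lambda>_. borel))"
    using s by (simp add: lpp_env_def cong: measurable_cong_sets)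
  have "distr (lpp_env m n \<sigma> \<sigma>) (PiM (grid m n) (\<lambda>_. borel)) ?f = lpp_env m n \<sigma> \<sigma>"
    unfolding lpp_env_def
    using Suc.prems assms by (intro distr_flip) (auto simp: grid_iff rates_def)
  then have "distr (lpp_env m n \<sigma> \<sigma>) (PiM (grid m n) (\<lambda>_. borel)) (sweep_row (Suc k) j) = lpp_env m n \<sigma> \<sigma>"
    unfolding eq using distr_distr[OF f s'] by (simp add: d)
  then show ?case using measurable_comp[OF s f] unfolding eq by (rule conjI[rotated])
qed

text \<open>
  Consequently $G - W$, as a function of the environment, has the law of the bottom sum: a sum of independent exponential
  variables.
\<close>

lemma sweep_measure_preserving:
  assumes "0 < \<sigma>" "\<sigma> < 1" "k \<le> n"
  shows "sweep m k \<in> measurable (PiM (grid m n) (\<lambda>_. borel)) (PiM (grid m n) (\<lambda>_. borel)) \<and>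
    distr (lpp_env m n \<sigma> \<sigma>) (PiM (grid m n) (\<lambda>_. borel)) (sweep m k) = lpp_env m n \<sigma> \<sigma>"
  using \<open>k \<le> n\<close>
proof (induction k)
  case 0
  have "sweep m 0 = (\<lambda>x. x)" by auto
  then show ?case by (simp add: lpp_env_def distr_id2)
next
  case (Suc k)
  let ?f = "sweep_row m (Suc k)"
  have eq: "sweep m (Suc k) = ?f \<circ> sweep m k" by auto
  have f: "?f \<in> measurable (PiM (grid m n) (\<lambda>_. borel)) (PiM (grid m n) (\<lambda>_. borel))"
    and df: "distr (lpp_env m n \<sigma> \<sigma>) (PiM (grid m n) (\<lambda>_. borel)) ?f = lpp_env m n \<sigma> \<sigma>"
    using sweep_row_measure_preserving[of \<sigma> m m "Suc k" n] Suc.prems assms by auto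
  have s: "sweep m k \<in> measurable (PiM (grid m n) (\<lambda>_. borel)) (PiM (grid m n) (\<lambda>_. borel))"
    and d: "distr (lpp_env m n \<sigma> \<sigma>) (PiM (grid m n) (\<lambda>_. borel)) (sweep m k) = lpp_env m n \<sigma> \<sigma>"
    using Suc by auto
  have s': "sweep m k \<in> measurable (lpp_env m n \<sigma> \<sigma>) (PiM (grid m n) (\<lambda>_. borel))"
    using s by (simp add: lpp_env_def cong: measurable_cong_sets)
  have "distr (lpp_env m n \<sigma> \<sigma>) (PiM (grid m n) (\<lambda>_. borel)) (sweep m (Suc k)) = lpp_env m n \<sigma> \<sigma>"
    unfolding eq using distr_distr[OF f s'] by (simp add: d df)
  then show ?case using measurable_comp[OF s f] unfolding eq by (rule conjI[rotated])
qed

section \<open>The moment generating function of the last-passage time\<close>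

lemma sets_lpp_env [simp, measurable_cong]:
  "sets (lpp_env m n \<sigma> \<tau>) = sets (PiM (grid m n) (\<lambda>_. borel))"
  by (simp add: lpp_env_def)

lemma rates_pos: "0 < \<tau> \<Longrightarrow> \<sigma> < 1 \<Longrightarrow> 0 < rates \<sigma> \<tau> p"
  by (simp add: rates_def)

lemma prob_space_lpp_env: "0 < \<tau> \<Longrightarrow> \<sigma> < 1 \<Longrightarrow> prob_space (lpp_env m n \<sigma> \<tau>)"
  unfolding lpp_env_def by (intro prob_space_expo_env rates_pos)

lemma AE_lpp_env_nonneg:
  "0 < \<tau> \<Longrightarrow> \<sigma> < 1 \<Longrightarrow> AE x in lpp_env m n \<sigma> \<tau>. \<forall>p\<in>grid m n. 0 \<le> x p"
  unfolding lpp_env_def by (intro AE_expo_env_nonneg finite_grid rates_pos)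

lemma measurable_bottom_sum [measurable]:
  "bottom_sum m \<in> borel_measurable (PiM (grid m n) (\<lambda>_. borel))"
  unfolding bottom_sum_def
  by (intro borel_measurable_sum measurable_component_singleton) (auto simp: grid_iff)

lemma measurable_left_sum [measurable]:
  "left_sum n \<in> borel_measurable (PiM (grid m n) (\<lambda>_. borel))"
  unfolding left_sum_def
  by (intro borel_measurable_sum measurable_component_singleton) (auto simp: grid_iff)

lemma prod_grid_left:
  fixes f :: "nat \<times> nat \<Rightarrow> real"
  assumes "\<And>i j. 0 < i \<Longrightarrow> f (i, j) = 1"
  shows "(\<Prod>p\<in>grid m n. f p) = (\<Prod>j<n. f (0, Suc j))"
proof -
  have "(\<Prod>p\<in>grid m n. f p) = (\<Prod>p\<in>(\<lambda>j. (0, Suc j)) ` {..<n}. f p)"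
  proof (rule prod.mono_neutral_right)
    show "\<forall>p\<in>grid m n - (\<lambda>j. (0, Suc j)) ` {..<n}. f p = 1"
    proof
      fix p assume p: "p \<in> grid m n - (\<lambda>j. (0, Suc j)) ` {..<n}"
      obtain i j where ij: "p = (i, j)" by (cases p)
      have "0 < i"
      proof (rule ccontr)
        assume "\<not> 0 < i"
        then have "p = (0, Suc (j - 1))" "j - 1 < n" using p ij by (auto simp: grid_iff)
        then show False using p by blast
      qed
      then show "f p = 1" using assms ij by simp
    qed
  qed (auto simp: grid_iff)
  then show ?thesis by (simp add: prod.reindex inj_on_def)
qed

lemma prod_grid_bottom:
  fixes f :: "nat \<times> nat \<Rightarrow> real"
  assumes "\<And>i j. 0 < j \<Longrightarrow> f (i, j) = 1"
  shows "(\<Prod>p\<in>grid m n. f p) = (\<Prod>i<m. f (Suc i, 0))"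
proof -
  have "(\<Prod>p\<in>grid m n. f p) = (\<Prod>p\<in>(\<lambda>i. (Suc i, 0)) ` {..<m}. f p)"
  proof (rule prod.mono_neutral_right)
    show "\<forall>p\<in>grid m n - (\<lambda>i. (Suc i, 0)) ` {..<m}. f p = 1"
    proof
      fix p assume p: "p \<in> grid m n - (\<lambda>i. (Suc i, 0)) ` {..<m}"
      obtain i j where ij: "p = (i, j)" by (cases p)
      have "0 < j"
      proof (rule ccontr)
        assume "\<not> 0 < j"
        then have "p = (Suc (i - 1), 0)" "i - 1 < m" using p ij by (auto simp: grid_iff)
        then show False using p by blast
      qed
      then show "f p = 1" using assms ij by simp
    qed
  qed (auto simp: grid_iff)
  then show ?thesis by (simp add: prod.reindex inj_on_def)
qed

lemma lpp_env_change_left: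
  assumes "0 < \<tau>" "0 < \<tau>'" "\<sigma> < 1"
  shows "lpp_env m n \<sigma> \<tau>' = density (lpp_env m n \<sigma> \<tau>)
    (\<lambda>x. ennreal ((\<tau>' / \<tau>) ^ n * exp ((\<tau> - \<tau>') * left_sum n x)))"
proof -
  have "(\<Prod>p\<in>grid m n. rates \<sigma> \<tau>' p / rates \<sigma> \<tau> p * exp ((rates \<sigma> \<tau> p - rates \<sigma> \<tau>' p) * x p))
    = (\<tau>' / \<tau>) ^ n * exp ((\<tau> - \<tau>') * left_sum n x)" for x
    using assms
    by (subst prod_grid_left) (auto simp: rates_def prod.distrib left_sum_def sum_distrib_left exp_sum
        prod_dividef power_divide)
  then show ?thesis
    unfolding lpp_env_def using assms
    by (subst expo_env_eq_density[of _ "rates \<sigma> \<tau>"]) (auto intro: rates_pos)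
qed

lemma lpp_env_change_bottom:
  assumes "0 < \<tau>" "\<sigma>' < 1" "\<sigma> < 1"
  shows "lpp_env m n \<sigma>' \<tau> = density (lpp_env m n \<sigma> \<tau>)
    (\<lambda>x. ennreal (((1 - \<sigma>') / (1 - \<sigma>)) ^ m * exp ((\<sigma>' - \<sigma>) * bottom_sum m x)))"
proof -
  have "(\<Prod>p\<in>grid m n. rates \<sigma>' \<tau> p / rates \<sigma> \<tau> p * exp ((rates \<sigma> \<tau> p - rates \<sigma>' \<tau> p) * x p))
    = ((1 - \<sigma>') / (1 - \<sigma>)) ^ m * exp ((\<sigma>' - \<sigma>) * bottom_sum m x)" for x
    using assms
    by (subst prod_grid_bottom) (auto simp: rates_def prod.distrib bottom_sum_def sum_distrib_left exp_sum
        prod_dividef power_divide)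
  then show ?thesis
    unfolding lpp_env_def using assms
    by (subst expo_env_eq_density[of _ "rates \<sigma> \<tau>"]) (auto intro: rates_pos)
qed

lemma lpp_env_rescale:
  assumes "0 < \<tau>" "0 < \<tau>'" "\<sigma> < 1" "\<sigma>' < 1"
  shows "distr (lpp_env m n \<sigma> \<tau>) (PiM (grid m n) (\<lambda>_. borel))
      (\<lambda>x. \<lambda>p\<in>grid m n. rates \<sigma> \<tau> p / rates \<sigma>' \<tau>' p * x p) = lpp_env m n \<sigma>' \<tau>'"
proof -
  have "0 < rates \<sigma> \<tau> p" "0 < rates \<sigma>' \<tau>' p" for p
    using assms by (auto intro: rates_pos)
  then show ?thesis
    unfolding lpp_env_def
    by (subst distr_expo_env_scale) (auto intro!: arg_cong[where f = "expo_env _"] simp: fun_eq_iff less_imp_neq[symmetric])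
qed

lemma nn_integral_lpp_rescale:
  fixes g :: "real \<Rightarrow> ennreal"
  assumes "0 < \<tau>" "0 < \<tau>'" "\<sigma> < 1" "\<sigma>' < 1" and [measurable]: "g \<in> borel_measurable borel"
  shows "(\<integral>\<^sup>+x. g (lpp x m n) \<partial>lpp_env m n \<sigma>' \<tau>') =
    (\<integral>\<^sup>+x. g (lpp (\<lambda>p. rates \<sigma> \<tau> p / rates \<sigma>' \<tau>' p * x p) m n) \<partial>lpp_env m n \<sigma> \<tau>)"
proof -
  have "(\<integral>\<^sup>+x. g (lpp x m n) \<partial>lpp_env m n \<sigma>' \<tau>') =
    (\<integral>\<^sup>+x. g (lpp (\<lambda>p\<in>grid m n. rates \<sigma> \<tau> p / rates \<sigma>' \<tau>' p * x p) m n) \<partial>lpp_env m n \<sigma> \<tau>)"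
    by (subst lpp_env_rescale[OF assms(1-4), symmetric]) (subst nn_integral_distr; measurable)
  also have "\<dots> = (\<integral>\<^sup>+x. g (lpp (\<lambda>p. rates \<sigma> \<tau> p / rates \<sigma>' \<tau>' p * x p) m n) \<partial>lpp_env m n \<sigma> \<tau>)"
    by (intro nn_integral_cong arg_cong[where f = g] lpp_cong) auto
  finally show ?thesis .
qed

definition lpp_mgf :: "nat \<Rightarrow> nat \<Rightarrow> real \<Rightarrow> real \<Rightarrow> real" where
  "lpp_mgf m n \<sigma> \<tau> = (\<tau> / \<sigma>) ^ n * ((1 - \<sigma>) / (1 - \<tau>)) ^ m"

lemma lpp_mgf_pos: "0 < \<sigma> \<Longrightarrow> \<sigma> < 1 \<Longrightarrow> 0 < \<tau> \<Longrightarrow> \<tau> < 1 \<Longrightarrow> 0 < lpp_mgf m n \<sigma> \<tau>"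
  by (simp add: lpp_mgf_def)

lemma nn_integral_sweep:
  fixes g :: "(nat \<times> nat \<Rightarrow> real) \<Rightarrow> ennreal"
  assumes "0 < \<sigma>" "\<sigma> < 1" and [measurable]: "g \<in> borel_measurable (PiM (grid m n) (\<lambda>_. borel))"
  shows "(\<integral>\<^sup>+x. g (sweep m n x) \<partial>lpp_env m n \<sigma> \<sigma>) = (\<integral>\<^sup>+x. g x \<partial>lpp_env m n \<sigma> \<sigma>)"
proof -
  have [measurable]: "sweep m n \<in> measurable (PiM (grid m n) (\<lambda>_. borel)) (PiM (grid m n) (\<lambda>_. borel))"
    and d: "distr (lpp_env m n \<sigma> \<sigma>) (PiM (grid m n) (\<lambda>_. borel)) (sweep m n) = lpp_env m n \<sigma> \<sigma>"
    using sweep_measure_preserving[of \<sigma> n n m] assms by auto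
  show ?thesis
    by (subst (2) d[symmetric], subst nn_integral_distr) measurable
qed

text \<open>
  Tilt the left rate from \<open>\<tau>\<close> to \<open>\<sigma>\<close>. The tilting factor $e^{(\sigma-\tau)W}$ turns the integrand
  $e^{(\tau-\sigma)G}$ into $e^{(\tau-\sigma)(G-W)}$, whose law under equal parameters is that of the
  bottom sum. The remaining exponential moment is the normalisation of a tilt of the bottom rate.
\<close>

lemma nn_integral_exp_lpp:
  assumes \<sigma>: "0 < \<sigma>" "\<sigma> < 1" and \<tau>: "0 < \<tau>" "\<tau> < 1"
  shows "(\<integral>\<^sup>+x. ennreal (exp ((\<tau> - \<sigma>) * lpp x m n)) \<partial>lpp_env m n \<sigma> \<tau>) = ennreal (lpp_mgf m n \<sigma> \<tau>)"
proof -
  let ?E = "lpp_env m n \<sigma> \<sigma>"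
  have 1: "(\<integral>\<^sup>+x. ennreal (((1 - \<tau>) / (1 - \<sigma>)) ^ m * exp ((\<tau> - \<sigma>) * bottom_sum m x)) \<partial>?E) = 1"
  proof -
    interpret prob_space "lpp_env m n \<tau> \<sigma>" using assms by (intro prob_space_lpp_env)
    have "1 = (\<integral>\<^sup>+x. 1 \<partial>lpp_env m n \<tau> \<sigma>)" by (simp add: emeasure_space_1)
    also have "\<dots> = (\<integral>\<^sup>+x. 1 \<partial>density ?E (\<lambda>x. ennreal (((1 - \<tau>) / (1 - \<sigma>)) ^ m *
        exp ((\<tau> - \<sigma>) * bottom_sum m x))))"
      using assms by (subst lpp_env_change_bottom[of \<sigma> \<tau> \<sigma>]) simp_all
    also have "\<dots> = (\<integral>\<^sup>+x. ennreal (((1 - \<tau>) / (1 - \<sigma>)) ^ m * exp ((\<tau> - \<sigma>) * bottom_sum m x)) * 1 \<partial>?E)"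
      by (rule nn_integral_density) measurable
    also have "\<dots> = (\<integral>\<^sup>+x. ennreal (((1 - \<tau>) / (1 - \<sigma>)) ^ m * exp ((\<tau> - \<sigma>) * bottom_sum m x)) \<partial>?E)"
      by simp
    finally show ?thesis ..
  qed
  have "(\<integral>\<^sup>+x. ennreal (exp ((\<tau> - \<sigma>) * lpp x m n)) \<partial>lpp_env m n \<sigma> \<tau>)
    = (\<integral>\<^sup>+x. ennreal ((\<tau> / \<sigma>) ^ n * exp ((\<sigma> - \<tau>) * left_sum n x)) * ennreal (exp ((\<tau> - \<sigma>) * lpp x m n)) \<partial>?E)"
    using assms by (subst lpp_env_change_left[of \<sigma> \<tau> \<sigma>]) (auto simp: nn_integral_density)
  also have "\<dots> = (\<integral>\<^sup>+x. ennreal ((\<tau> / \<sigma>) ^ n * exp ((\<tau> - \<sigma>) * bottom_sum m (sweep m n x))) \<partial>?E)"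
    using assms by (intro nn_integral_cong)
      (simp add: bottom_sum_sweep ennreal_mult'[symmetric] mult_exp_exp algebra_simps)
  also have "\<dots> = (\<integral>\<^sup>+x. ennreal ((\<tau> / \<sigma>) ^ n * exp ((\<tau> - \<sigma>) * bottom_sum m x)) \<partial>?E)"
    using \<sigma> by (rule nn_integral_sweep) measurable
  also have "\<dots> = (\<integral>\<^sup>+x. ennreal (lpp_mgf m n \<sigma> \<tau>) *
      ennreal (((1 - \<tau>) / (1 - \<sigma>)) ^ m * exp ((\<tau> - \<sigma>) * bottom_sum m x)) \<partial>?E)"
  proof (rule nn_integral_cong)
    fix x
    have "(\<tau> / \<sigma>) ^ n * exp ((\<tau> - \<sigma>) * bottom_sum m x) = lpp_mgf m n \<sigma> \<tau> *
      (((1 - \<tau>) / (1 - \<sigma>)) ^ m * exp ((\<tau> - \<sigma>) * bottom_sum m x))"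
      using assms by (simp add: lpp_mgf_def power_divide)
    then show "ennreal ((\<tau> / \<sigma>) ^ n * exp ((\<tau> - \<sigma>) * bottom_sum m x)) = ennreal (lpp_mgf m n \<sigma> \<tau>) *
      ennreal (((1 - \<tau>) / (1 - \<sigma>)) ^ m * exp ((\<tau> - \<sigma>) * bottom_sum m x))"
      using lpp_mgf_pos[OF assms, of m n] by (simp only: ennreal_mult'[OF less_imp_le])
  qed
  also have "\<dots> = ennreal (lpp_mgf m n \<sigma> \<tau>)"
    by (subst nn_integral_cmult) (auto simp: 1)
  finally show ?thesis .
qed

text \<open>
  Each of the two comparison models keeps one boundary and has parameters that differ by exactly
  \<open>u\<close>, so that its exponential moment of order \<open>u\<close> is known.
\<close>

lemma nn_integral_exp_lpp_le:
  assumes u: "0 < u" "\<sigma> + u < 1" "u < \<tau>" and "0 < \<sigma>" "\<tau> < 1"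
  shows "(\<integral>\<^sup>+x. ennreal (exp (u * lpp x m n)) \<partial>lpp_env m n \<sigma> \<tau>)
    \<le> ennreal (lpp_mgf m n \<sigma> (\<sigma> + u) + lpp_mgf m n (\<tau> - u) \<tau>)"
proof -
  let ?s = "\<lambda>\<sigma>' \<tau>' x p. rates \<sigma> \<tau> p / rates \<sigma>' \<tau>' p * x p"
  let ?e = "\<lambda>y. ennreal (exp (u * y))"
  let ?E = "lpp_env m n \<sigma> \<tau>"
  have meas: "(\<lambda>x. ?e (lpp (?s \<sigma>' \<tau>' x) m n)) \<in> borel_measurable ?E" for \<sigma>' \<tau>'
  proof -
    have "(\<lambda>x. ?e (lpp (\<lambda>p\<in>grid m n. ?s \<sigma>' \<tau>' x p) m n)) \<in> borel_measurable ?E" by measurable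
    also have "(\<lambda>x. ?e (lpp (\<lambda>p\<in>grid m n. ?s \<sigma>' \<tau>' x p) m n)) = (\<lambda>x. ?e (lpp (?s \<sigma>' \<tau>' x) m n))"
      by (intro ext arg_cong[where f = ?e] lpp_cong) auto
    finally show ?thesis .
  qed
  have "(\<integral>\<^sup>+x. ?e (lpp x m n) \<partial>?E) \<le>
    (\<integral>\<^sup>+x. ?e (lpp (?s \<sigma> (\<sigma> + u) x) m n) + ?e (lpp (?s (\<tau> - u) \<tau> x) m n) \<partial>?E)"
  proof (rule nn_integral_mono)
    fix x
    have "lpp x m n \<le> max (lpp (?s \<sigma> (\<sigma> + u) x) m n) (lpp (?s (\<tau> - u) \<tau> x) m n)"
      using assms by (intro lpp_le_max) (auto simp: rates_def)
    then have "exp (u * lpp x m n) \<le> exp (u * lpp (?s \<sigma> (\<sigma> + u) x) m n) + exp (u * lpp (?s (\<tau> - u) \<tau> x) m n)"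
    proof (cases "lpp x m n \<le> lpp (?s \<sigma> (\<sigma> + u) x) m n")
      case True
      then show ?thesis using u by (intro add_increasing2) auto
    next
      case False
      with \<open>lpp x m n \<le> max _ _\<close> have "lpp x m n \<le> lpp (?s (\<tau> - u) \<tau> x) m n" by linarith
      then show ?thesis using u by (intro add_increasing) auto
    qed
    then show "?e (lpp x m n) \<le> ?e (lpp (?s \<sigma> (\<sigma> + u) x) m n) + ?e (lpp (?s (\<tau> - u) \<tau> x) m n)"
      by (simp add: ennreal_plus[symmetric] del: ennreal_plus)
  qed
  also have "\<dots> = (\<integral>\<^sup>+x. ?e (lpp (?s \<sigma> (\<sigma> + u) x) m n) \<partial>?E) + (\<integral>\<^sup>+x. ?e (lpp (?s (\<tau> - u) \<tau> x) m n) \<partial>?E)"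
    by (intro nn_integral_add meas)
  also have "(\<integral>\<^sup>+x. ?e (lpp (?s \<sigma> (\<sigma> + u) x) m n) \<partial>?E) = ennreal (lpp_mgf m n \<sigma> (\<sigma> + u))"
    using nn_integral_lpp_rescale[of \<tau> "\<sigma> + u" \<sigma> \<sigma> ?e m n] nn_integral_exp_lpp[of \<sigma> "\<sigma> + u" m n] assms by simp
  also have "(\<integral>\<^sup>+x. ?e (lpp (?s (\<tau> - u) \<tau> x) m n) \<partial>?E) = ennreal (lpp_mgf m n (\<tau> - u) \<tau>)"
    using nn_integral_lpp_rescale[of \<tau> \<tau> \<sigma> "\<tau> - u" ?e m n] nn_integral_exp_lpp[of "\<tau> - u" \<tau> m n] assms by simp
  also have "ennreal (lpp_mgf m n \<sigma> (\<sigma> + u)) + ennreal (lpp_mgf m n (\<tau> - u) \<tau>)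
      = ennreal (lpp_mgf m n \<sigma> (\<sigma> + u) + lpp_mgf m n (\<tau> - u) \<tau>)"
    using assms by (intro ennreal_plus[symmetric] less_imp_le lpp_mgf_pos) auto
  finally show ?thesis .
qed

text \<open>
  Both boundary rates of the comparison model are larger, so its weights are the stationary ones
  multiplied by factors at most one.
\<close>

lemma nn_integral_exp_lpp_ge:
  assumes "0 < \<sigma>" "\<sigma> \<le> \<rho>" "\<rho> \<le> \<tau>" "\<tau> < 1"
  shows "ennreal (lpp_mgf m n \<sigma> \<tau>) \<le> (\<integral>\<^sup>+x. ennreal (exp ((\<tau> - \<sigma>) * lpp x m n)) \<partial>lpp_env m n \<rho> \<rho>)"
proof -
  have "ennreal (lpp_mgf m n \<sigma> \<tau>) = (\<integral>\<^sup>+x. ennreal (exp ((\<tau> - \<sigma>) * lpp x m n)) \<partial>lpp_env m n \<sigma> \<tau>)"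
    using assms by (intro nn_integral_exp_lpp[symmetric]) auto
  also have "\<dots> = (\<integral>\<^sup>+x. ennreal (exp ((\<tau> - \<sigma>) *
      lpp (\<lambda>p. rates \<rho> \<rho> p / rates \<sigma> \<tau> p * x p) m n)) \<partial>lpp_env m n \<rho> \<rho>)"
    using assms by (intro nn_integral_lpp_rescale[where g = "\<lambda>y. ennreal (exp ((\<tau> - \<sigma>) * y))"]) auto
  also have "\<dots> \<le> (\<integral>\<^sup>+x. ennreal (exp ((\<tau> - \<sigma>) * lpp x m n)) \<partial>lpp_env m n \<rho> \<rho>)"
  proof (rule nn_integral_mono_AE)
    have "AE x in lpp_env m n \<rho> \<rho>. \<forall>p\<in>grid m n. 0 \<le> x p"
      using assms by (intro AE_lpp_env_nonneg) auto
    then show "AE x in lpp_env m n \<rho> \<rho>. ennreal (exp ((\<tau> - \<sigma>) *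
      lpp (\<lambda>p. rates \<rho> \<rho> p / rates \<sigma> \<tau> p * x p) m n)) \<le> ennreal (exp ((\<tau> - \<sigma>) * lpp x m n))"
    proof eventually_elim
      case (elim x)
      have "rates \<rho> \<rho> p / rates \<sigma> \<tau> p \<le> 1" for p
        using assms by (auto simp: rates_def)
      then have "rates \<rho> \<rho> p / rates \<sigma> \<tau> p * x p \<le> x p" if "p \<in> grid m n" for p
        using mult_right_mono[of "rates \<rho> \<rho> p / rates \<sigma> \<tau> p" 1 "x p"] elim that by simp
      then have "lpp (\<lambda>p. rates \<rho> \<rho> p / rates \<sigma> \<tau> p * x p) m n \<le> lpp x m n"
        by (rule lpp_mono)
      then show ?case using assms by (auto intro!: mult_left_mono)
    qed
  qed
  finally show ?thesis .
qed

section \<open>Variance bounds for a fixed rectangle\<close>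

text \<open>
  Independence of the coordinates identifies the two boundary sums as Erlang variables.
\<close>

lemma indep_vars_expo_env:
  assumes r: "\<And>p. p \<in> A \<Longrightarrow> 0 < r p" and "A \<noteq> {}"
  shows "prob_space.indep_vars (expo_env A r) (\<lambda>_. borel) (\<lambda>p x. x p) A"
proof -
  interpret prob_space "expo_env A r" by (rule prob_space_expo_env[OF r])
  have "distr (expo_env A r) (PiM A (\<lambda>_. borel)) (\<lambda>x. \<lambda>p\<in>A. x p) = distr (expo_env A r) (PiM A (\<lambda>_. borel)) (\<lambda>x. x)"
    by (intro distr_cong) (auto simp: PiE_def extensional_restrict)
  also have "\<dots> = expo_env A r"
    by (simp add: distr_id2)
  also have "\<dots> = PiM A (\<lambda>p. distr (expo_env A r) borel (\<lambda>x. x p))"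
  proof -
    have "distr (expo_env A r) borel (\<lambda>x. x p) = expo (r p)" if "p \<in> A" for p
    proof -
      have "distr (expo_env A r) borel (\<lambda>x. x p) = distr (PiM A (\<lambda>p. expo (r p))) (expo (r p)) (\<lambda>x. x p)"
        unfolding expo_env_def by (intro distr_cong) auto
      also have "\<dots> = expo (r p)"
        using that by (intro distr_PiM_component prob_space_expo r)
      finally show ?thesis .
    qed
    then show ?thesis
      unfolding expo_env_def by (intro PiM_cong) (auto simp: expo_env_def)
  qed
  finally show ?thesis
    using \<open>A \<noteq> {}\<close> by (subst indep_vars_iff_distr_eq_PiM') (auto simp: expo_env_def)
qed

lemma distributed_expo_env_component:
  assumes r: "\<And>p. p \<in> A \<Longrightarrow> 0 < r p" and "p \<in> A"
  shows "distributed (expo_env A r) lborel (\<lambda>x. x p) (exponential_density (r p))"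
proof -
  have [measurable]: "(\<lambda>x. x p) \<in> borel_measurable (PiM A (\<lambda>_. borel :: real measure))"
    by (rule measurable_component_singleton) fact
  have "distr (expo_env A r) lborel (\<lambda>x. x p) = distr (PiM A (\<lambda>p. expo (r p))) (expo (r p)) (\<lambda>x. x p)"
    unfolding expo_env_def by (intro distr_cong) auto
  also have "\<dots> = expo (r p)"
    using assms by (intro distr_PiM_component prob_space_expo r)
  finally show ?thesis
    unfolding distributed_def expo_def by auto
qed

lemma distributed_expo_env_sum:
  assumes "finite A" and r: "\<And>p. p \<in> A \<Longrightarrow> 0 < r p" and I: "I \<subseteq> A" "I \<noteq> {}" "\<And>p. p \<in> I \<Longrightarrow> r p = l"
  shows "distributed (expo_env A r) lborel (\<lambda>x. \<Sum>p\<in>I. x p) (erlang_density (card I - 1) l)"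
proof -
  interpret prob_space "expo_env A r" by (rule prob_space_expo_env[OF r])
  obtain p where p: "p \<in> I" using I by auto
  show ?thesis
  proof (rule exponential_distributed_sum)
    show "finite I" using I \<open>finite A\<close> finite_subset by auto
    show "0 < l" using p I r[of p] by auto
    show "distributed (expo_env A r) lborel (\<lambda>x. x p) (exponential_density l)" if "p \<in> I" for p
      using distributed_expo_env_component[of A r p] r I that by auto
    show "indep_vars (\<lambda>i. borel) (\<lambda>p x. x p) I"
      using indep_vars_expo_env[of A r] r I by (intro indep_vars_subset[of _ _ A I]) auto
  qed fact
qed

lemma distributed_bottom_sum:
  assumes "0 < m" "0 < \<tau>" "\<sigma> < 1"
  shows "distributed (lpp_env m n \<sigma> \<tau>) lborel (bottom_sum m) (erlang_density (m - 1) (1 - \<sigma>))"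
proof -
  let ?I = "(\<lambda>i. (Suc i, 0::nat)) ` {..<m}"
  have "distributed (lpp_env m n \<sigma> \<tau>) lborel (\<lambda>x. \<Sum>p\<in>?I. x p) (erlang_density (card ?I - 1) (1 - \<sigma>))"
    unfolding lpp_env_def using assms
    by (intro distributed_expo_env_sum rates_pos) (auto simp: grid_iff rates_def)
  moreover have "(\<lambda>x. \<Sum>p\<in>?I. x p) = bottom_sum m"
    by (auto simp: bottom_sum_def sum.reindex inj_on_def)
  moreover have "card ?I = m" by (simp add: card_image inj_on_def)
  ultimately show ?thesis by simp
qed

lemma distributed_left_sum:
  assumes "0 < n" "0 < \<tau>" "\<sigma> < 1"
  shows "distributed (lpp_env m n \<sigma> \<tau>) lborel (left_sum n) (erlang_density (n - 1) \<tau>)"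
proof -
  let ?I = "(\<lambda>j. (0::nat, Suc j)) ` {..<n}"
  have "distributed (lpp_env m n \<sigma> \<tau>) lborel (\<lambda>x. \<Sum>p\<in>?I. x p) (erlang_density (card ?I - 1) \<tau>)"
    unfolding lpp_env_def using assms
    by (intro distributed_expo_env_sum rates_pos) (auto simp: grid_iff rates_def)
  moreover have "(\<lambda>x. \<Sum>p\<in>?I. x p) = left_sum n"
    by (auto simp: left_sum_def sum.reindex inj_on_def)
  moreover have "card ?I = n" by (simp add: card_image inj_on_def)
  ultimately show ?thesis by simp
qed

lemma (in prob_space) erlang_moments:
  assumes "0 < l" "0 < k" and D: "distributed M lborel X (erlang_density (k - 1) l)"
  shows "integrable M X" "integrable M (\<lambda>x. (X x)\<^sup>2)"
    "expectation X = k / l" "expectation (\<lambda>x. (X x)\<^sup>2) = k / l\<^sup>2 + (k / l)\<^sup>2"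
proof -
  show 1: "integrable M X" and 2: "integrable M (\<lambda>x. (X x)\<^sup>2)"
    using erlang_ith_moment_integrable[OF assms(1) D, of 1] erlang_ith_moment_integrable[OF assms(1) D, of 2] by auto
  show 3: "expectation X = k / l"
    using erlang_ith_moment[OF assms(1) D, of 1] \<open>0 < k\<close> by (cases k) (simp_all del: of_nat_Suc)
  have "variance X = k / l\<^sup>2"
    using erlang_distributed_variance[OF assms(1) D] \<open>0 < k\<close> by (simp add: of_nat_diff)
  then show "expectation (\<lambda>x. (X x)\<^sup>2) = k / l\<^sup>2 + (k / l)\<^sup>2"
    using variance_eq[OF 1 2] 3 by simp
qed

lemma integrable_exp_lpp:
  assumes "0 < \<sigma>" "\<sigma> < 1" "0 < \<tau>" "\<tau> < 1" "0 < u" "\<sigma> + u < 1" "u < \<tau>"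
  shows "integrable (lpp_env m n \<sigma> \<tau>) (\<lambda>x. exp (u * lpp x m n))"
    "integral\<^sup>L (lpp_env m n \<sigma> \<tau>) (\<lambda>x. exp (u * lpp x m n)) \<le> lpp_mgf m n \<sigma> (\<sigma> + u) + lpp_mgf m n (\<tau> - u) \<tau>"
proof -
  note le = nn_integral_exp_lpp_le[of u \<sigma> \<tau> m n]
  show "integrable (lpp_env m n \<sigma> \<tau>) (\<lambda>x. exp (u * lpp x m n))"
    using le assms by (intro integrableI_nonneg) (auto intro: le_less_trans)
  show "integral\<^sup>L (lpp_env m n \<sigma> \<tau>) (\<lambda>x. exp (u * lpp x m n)) \<le> lpp_mgf m n \<sigma> (\<sigma> + u) + lpp_mgf m n (\<tau> - u) \<tau>"
    using le assms by (intro integral_real_bounded add_nonneg_nonneg less_imp_le[OF lpp_mgf_pos]) auto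
qed

lemma integrable_lpp:
  assumes "0 < \<sigma>" "\<sigma> < 1" "0 < \<tau>" "\<tau> < 1"
  shows "integrable (lpp_env m n \<sigma> \<tau>) (\<lambda>x. lpp x m n)"
    "integrable (lpp_env m n \<sigma> \<tau>) (\<lambda>x. (lpp x m n)\<^sup>2)"
proof -
  interpret prob_space "lpp_env m n \<sigma> \<tau>" using assms by (intro prob_space_lpp_env)
  define u where "u = min (1 - \<sigma>) \<tau> / 2"
  have u: "0 < u" "\<sigma> + u < 1" "u < \<tau>" using assms by (auto simp: u_def min_def field_simps)
  show *: "integrable (lpp_env m n \<sigma> \<tau>) (\<lambda>x. (lpp x m n)\<^sup>2)"
  proof (rule Bochner_Integration.integrable_bound)
    show "integrable (lpp_env m n \<sigma> \<tau>) (\<lambda>x. 2 / u\<^sup>2 * exp (u * lpp x m n))"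
      using integrable_exp_lpp(1)[OF assms u] by simp
    have "AE x in lpp_env m n \<sigma> \<tau>. \<forall>p\<in>grid m n. 0 \<le> x p"
      using assms by (intro AE_lpp_env_nonneg) auto
    then show "AE x in lpp_env m n \<sigma> \<tau>. norm ((lpp x m n)\<^sup>2) \<le> norm (2 / u\<^sup>2 * exp (u * lpp x m n))"
    proof eventually_elim
      case (elim x)
      then have "0 \<le> u * lpp x m n" using lpp_nonneg u by simp
      from exp_lower_Taylor_quadratic[OF this] this
      have "(u * lpp x m n)\<^sup>2 / 2 \<le> exp (u * lpp x m n)" by linarith
      then show ?case using u by (simp add: field_simps)
    qed
  qed measurable
  show "integrable (lpp_env m n \<sigma> \<tau>) (\<lambda>x. lpp x m n)"
    by (rule square_integrable_imp_integrable[OF _ *]) measurable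
qed

definition lpp_mean :: "nat \<Rightarrow> nat \<Rightarrow> real \<Rightarrow> real" where
  "lpp_mean m n \<rho> = m / (1 - \<rho>) + n / \<rho>"

lemma sweep_integral:
  fixes f :: "real \<Rightarrow> real"
  assumes "0 < \<rho>" "\<rho> < 1" and [measurable]: "f \<in> borel_measurable borel"
  shows "integrable (lpp_env m n \<rho> \<rho>) (\<lambda>x. f (lpp x m n - left_sum n x)) \<longleftrightarrow>
      integrable (lpp_env m n \<rho> \<rho>) (\<lambda>x. f (bottom_sum m x))"
    "(\<integral>x. f (lpp x m n - left_sum n x) \<partial>lpp_env m n \<rho> \<rho>) = (\<integral>x. f (bottom_sum m x) \<partial>lpp_env m n \<rho> \<rho>)"
proof -
  have [measurable]: "sweep m n \<in> measurable (PiM (grid m n) (\<lambda>_. borel)) (PiM (grid m n) (\<lambda>_. borel))"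
    and d: "distr (lpp_env m n \<rho> \<rho>) (PiM (grid m n) (\<lambda>_. borel)) (sweep m n) = lpp_env m n \<rho> \<rho>"
    using sweep_measure_preserving[of \<rho> n n m] assms by auto
  have [measurable]: "sweep m n \<in> measurable (lpp_env m n \<rho> \<rho>) (PiM (grid m n) (\<lambda>_. borel))" by measurable
  show "integrable (lpp_env m n \<rho> \<rho>) (\<lambda>x. f (lpp x m n - left_sum n x)) \<longleftrightarrow>
      integrable (lpp_env m n \<rho> \<rho>) (\<lambda>x. f (bottom_sum m x))"
    unfolding bottom_sum_sweep[symmetric]
    by (subst (2) d[symmetric], subst integrable_distr_eq) simp_all
  show "(\<integral>x. f (lpp x m n - left_sum n x) \<partial>lpp_env m n \<rho> \<rho>) = (\<integral>x. f (bottom_sum m x) \<partial>lpp_env m n \<rho> \<rho>)"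
    unfolding bottom_sum_sweep[symmetric]
    by (subst (2) d[symmetric], subst integral_distr) simp_all
qed

context
  fixes m n :: nat and \<rho> :: real
  assumes pos: "0 < m" "0 < n" and \<rho>: "0 < \<rho>" "\<rho> < 1"
begin

interpretation prob_space "lpp_env m n \<rho> \<rho>"
  using \<rho> by (intro prob_space_lpp_env)

lemmas left_moments = erlang_moments[OF \<rho>(1) pos(2) distributed_left_sum[OF pos(2) \<rho>, of m]]
lemmas bottom_moments = erlang_moments[OF _ pos(1) distributed_bottom_sum[OF pos(1) \<rho>, of n], simplified, OF \<rho>(2)]

lemma integrable_left_lpp: "integrable (lpp_env m n \<rho> \<rho>) (\<lambda>x. left_sum n x * lpp x m n)"
proof (rule Bochner_Integration.integrable_bound)
  show "integrable (lpp_env m n \<rho> \<rho>) (\<lambda>x. (left_sum n x)\<^sup>2 + (lpp x m n)\<^sup>2)"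
    using left_moments(2) integrable_lpp(2)[of \<rho> \<rho>] \<rho> by simp
  have "\<bar>a * b\<bar> \<le> a\<^sup>2 + b\<^sup>2" for a b :: real
  proof -
    have "2 * (\<bar>a\<bar> * \<bar>b\<bar>) \<le> a\<^sup>2 + b\<^sup>2"
      using sum_squares_bound[of "\<bar>a\<bar>" "\<bar>b\<bar>"] by (simp add: mult.assoc)
    moreover have "0 \<le> \<bar>a\<bar> * \<bar>b\<bar>" by simp
    ultimately show ?thesis unfolding abs_mult by linarith
  qed
  then show "AE x in lpp_env m n \<rho> \<rho>. norm (left_sum n x * lpp x m n) \<le> norm ((left_sum n x)\<^sup>2 + (lpp x m n)\<^sup>2)"
    by simp
qed measurable

lemma expectation_lpp: "expectation (\<lambda>x. lpp x m n) = lpp_mean m n \<rho>"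
proof -
  have "expectation (\<lambda>x. lpp x m n) = expectation (\<lambda>x. left_sum n x + (lpp x m n - left_sum n x))"
    by simp
  also have "\<dots> = expectation (left_sum n) + expectation (\<lambda>x. lpp x m n - left_sum n x)"
    using left_moments(1) integrable_lpp(1)[of \<rho> \<rho> m n] \<rho>
    by (intro Bochner_Integration.integral_add) auto
  also have "expectation (\<lambda>x. lpp x m n - left_sum n x) = expectation (bottom_sum m)"
    using sweep_integral(2)[OF \<rho>, of "\<lambda>y. y"] by simp
  finally show ?thesis by (simp add: left_moments bottom_moments lpp_mean_def)
qed

text \<open>
  Expand $G^2 = (G-W)^2 - W^2 + 2WG$: the first two terms have known expectations by the Burke
  property, which leaves the covariance of \<open>W\<close> and \<open>G\<close> as the only unknown.
\<close>

lemma variance_lpp: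
  "variance (\<lambda>x. lpp x m n) = m / (1 - \<rho>)\<^sup>2 - n / \<rho>\<^sup>2 +
    2 * (expectation (\<lambda>x. left_sum n x * lpp x m n) - n / \<rho> * lpp_mean m n \<rho>)"
proof -
  have int: "integrable (lpp_env m n \<rho> \<rho>) (\<lambda>x. (lpp x m n - left_sum n x)\<^sup>2)"
    using sweep_integral(1)[OF \<rho>, of "\<lambda>y. y\<^sup>2"] bottom_moments(2) by simp
  have "expectation (\<lambda>x. (lpp x m n)\<^sup>2) =
      expectation (\<lambda>x. (lpp x m n - left_sum n x)\<^sup>2 - (left_sum n x)\<^sup>2 + 2 * (left_sum n x * lpp x m n))"
    by (intro Bochner_Integration.integral_cong refl) (simp add: power2_eq_square algebra_simps)
  also have "\<dots> = expectation (\<lambda>x. (lpp x m n - left_sum n x)\<^sup>2) - expectation (\<lambda>x. (left_sum n x)\<^sup>2)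
      + 2 * expectation (\<lambda>x. left_sum n x * lpp x m n)"
    using int left_moments(2) integrable_left_lpp by simp
  also have "expectation (\<lambda>x. (lpp x m n - left_sum n x)\<^sup>2) = expectation (\<lambda>x. (bottom_sum m x)\<^sup>2)"
    using sweep_integral(2)[OF \<rho>, of "\<lambda>y. y\<^sup>2"] by simp
  finally have 1: "expectation (\<lambda>x. (lpp x m n)\<^sup>2) = m / (1 - \<rho>)\<^sup>2 + (m / (1 - \<rho>))\<^sup>2 - (n / \<rho>\<^sup>2 + (n / \<rho>)\<^sup>2)
      + 2 * expectation (\<lambda>x. left_sum n x * lpp x m n)"
    by (simp add: left_moments bottom_moments)
  have 2: "(m / (1 - \<rho>))\<^sup>2 - (n / \<rho>)\<^sup>2 - (lpp_mean m n \<rho>)\<^sup>2 = - 2 * (n / \<rho> * lpp_mean m n \<rho>)"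
    by (simp add: lpp_mean_def power2_eq_square algebra_simps)
  have 3: "variance (\<lambda>x. lpp x m n) = expectation (\<lambda>x. (lpp x m n)\<^sup>2) - (lpp_mean m n \<rho>)\<^sup>2"
    using integrable_lpp[of \<rho> \<rho> m n] \<rho> by (subst variance_eq) (auto simp: expectation_lpp)
  have "v = a - b + 2 * (k - c)"
    if "g = a + a' - (b + b') + 2 * k" "a' - b' - q = - 2 * c" "v = g - q" for v g a a' b b' k q c :: real
    using that by (simp add: algebra_simps)
  from this[OF 1 2 3] show ?thesis .
qed

lemma expectation_stretched_left:
  fixes h :: real
  assumes "0 \<le> h"
  shows "integrable (lpp_env m n \<rho> \<rho>) (\<lambda>x. lpp (\<lambda>p. (if fst p = 0 then 1 + h else 1) * x p) m n)"
    "expectation (\<lambda>x. lpp (\<lambda>p. (if fst p = 0 then 1 + h else 1) * x p) m n)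
      = (\<integral>x. lpp x m n \<partial>lpp_env m n \<rho> (\<rho> / (1 + h)))"
proof -
  let ?\<tau> = "\<rho> / (1 + h)"
  have \<tau>: "0 < ?\<tau>" "?\<tau> < 1" using assms \<rho> by (auto simp: field_simps)
  let ?T = "\<lambda>x. \<lambda>p\<in>grid m n. rates \<rho> \<rho> p / rates \<rho> ?\<tau> p * x p"
  have T: "?T \<in> measurable (lpp_env m n \<rho> \<rho>) (PiM (grid m n) (\<lambda>_. borel))" by measurable
  have d: "distr (lpp_env m n \<rho> \<rho>) (PiM (grid m n) (\<lambda>_. borel)) ?T = lpp_env m n \<rho> ?\<tau>"
    using \<rho> \<tau> by (intro lpp_env_rescale) auto
  have eq: "lpp (?T x) m n = lpp (\<lambda>p. (if fst p = 0 then 1 + h else 1) * x p) m n" for x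
    using assms \<rho> by (intro lpp_cong) (auto simp: rates_def grid_iff)
  show "integrable (lpp_env m n \<rho> \<rho>) (\<lambda>x. lpp (\<lambda>p. (if fst p = 0 then 1 + h else 1) * x p) m n)"
  proof -
    have "integrable (distr (lpp_env m n \<rho> \<rho>) (PiM (grid m n) (\<lambda>_. borel)) ?T) (\<lambda>x. lpp x m n)"
      unfolding d using \<rho> \<tau> by (intro integrable_lpp(1))
    then show ?thesis
      by (subst (asm) integrable_distr_eq[OF T measurable_lpp]) (simp only: eq)
  qed
  show "expectation (\<lambda>x. lpp (\<lambda>p. (if fst p = 0 then 1 + h else 1) * x p) m n)
      = (\<integral>x. lpp x m n \<partial>lpp_env m n \<rho> ?\<tau>)"
    unfolding d[symmetric] by (subst integral_distr[OF T measurable_lpp]) (simp only: eq)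
qed

text \<open>
  The expectation of $G$ with left rate $\varrho/(1+h)$ is bounded below by its linearisation in the tilt
  of the left weights: the tilting density is an exponential and $e^y \ge 1 + y$. Working with
  this inequality avoids differentiating under the integral sign.
\<close>

lemma expectation_slower_left_ge:
  fixes h :: real
  assumes "0 \<le> h"
  shows "lpp_mean m n \<rho> + (\<rho> * h / (1 + h)) * expectation (\<lambda>x. left_sum n x * lpp x m n) - n * h * lpp_mean m n \<rho>
    \<le> (\<integral>x. lpp x m n \<partial>lpp_env m n \<rho> (\<rho> / (1 + h)))"
proof -
  let ?\<tau> = "\<rho> / (1 + h)"
  have \<tau>: "0 < ?\<tau>" "?\<tau> < 1" using assms \<rho> by (auto simp: field_simps)
  let ?d = "\<lambda>x. (?\<tau> / \<rho>) ^ n * exp ((\<rho> - ?\<tau>) * left_sum n x)"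
  have E: "lpp_env m n \<rho> ?\<tau> = density (lpp_env m n \<rho> \<rho>) ?d"
    using \<rho> \<tau> by (intro lpp_env_change_left)
  have d0: "0 \<le> ?d x" for x using \<rho> \<tau> assms by simp
  have intd: "integrable (lpp_env m n \<rho> \<rho>) (\<lambda>x. ?d x * lpp x m n)"
    using integrable_lpp(1)[of \<rho> ?\<tau> m n] \<rho> \<tau> d0 unfolding E
    by (subst (asm) integrable_density) auto
  have \<rho>\<tau>: "\<rho> - ?\<tau> = \<rho> * h / (1 + h)" using assms by (simp add: field_simps)
  have "expectation (\<lambda>x. lpp x m n + (\<rho> * h / (1 + h)) * (left_sum n x * lpp x m n) - n * h * lpp x m n)
    \<le> expectation (\<lambda>x. ?d x * lpp x m n)"
  proof (rule integral_mono_AE)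
    show "integrable (lpp_env m n \<rho> \<rho>)
        (\<lambda>x. lpp x m n + (\<rho> * h / (1 + h)) * (left_sum n x * lpp x m n) - n * h * lpp x m n)"
      using integrable_lpp(1)[of \<rho> \<rho> m n] \<rho> integrable_left_lpp by simp
    show "integrable (lpp_env m n \<rho> \<rho>) (\<lambda>x. ?d x * lpp x m n)" by fact
    have "AE x in lpp_env m n \<rho> \<rho>. \<forall>p\<in>grid m n. 0 \<le> x p"
      using \<rho> by (intro AE_lpp_env_nonneg) auto
    then show "AE x in lpp_env m n \<rho> \<rho>. lpp x m n + (\<rho> * h / (1 + h)) * (left_sum n x * lpp x m n) - n * h * lpp x m n
        \<le> ?d x * lpp x m n"
    proof eventually_elim
      case (elim x)
      then have G: "0 \<le> lpp x m n" using lpp_nonneg by simp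
      have "(?\<tau> / \<rho>) ^ n = exp (- (n * ln (1 + h)))"
      proof -
        have "?\<tau> / \<rho> = exp (- ln (1 + h))"
          using assms \<rho> by (simp add: exp_minus inverse_eq_divide)
        then show ?thesis by (simp add: exp_of_nat_mult[symmetric])
      qed
      then have "?d x = exp ((\<rho> * h / (1 + h)) * left_sum n x - n * ln (1 + h))"
        by (simp add: \<rho>\<tau> mult_exp_exp)
      moreover have "\<dots> \<ge> 1 + ((\<rho> * h / (1 + h)) * left_sum n x - n * ln (1 + h))"
        by (rule exp_ge_add_one_self)
      moreover have "n * ln (1 + h) \<le> n * h"
        using ln_add_one_self_le_self[OF assms] by (intro mult_left_mono) auto
      ultimately have "1 + (\<rho> * h / (1 + h)) * left_sum n x - n * h \<le> ?d x" by linarith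
      from mult_right_mono[OF this G] show ?case by (simp add: algebra_simps)
    qed
  qed
  also have "expectation (\<lambda>x. ?d x * lpp x m n) = (\<integral>x. lpp x m n \<partial>lpp_env m n \<rho> ?\<tau>)"
    unfolding E using d0 by (subst integral_density) auto
  also have "expectation (\<lambda>x. lpp x m n + (\<rho> * h / (1 + h)) * (left_sum n x * lpp x m n) - n * h * lpp x m n)
    = lpp_mean m n \<rho> + (\<rho> * h / (1 + h)) * expectation (\<lambda>x. left_sum n x * lpp x m n) - n * h * lpp_mean m n \<rho>"
    using integrable_lpp(1)[of \<rho> \<rho> m n] \<rho> integrable_left_lpp by (simp add: expectation_lpp)
  finally show ?thesis .
qed

text \<open>
  The derivative of a convex function is at most any forward difference quotient. Here the function
  is the mean of $G$ when the left weights are multiplied by $1+h$; at $h = 0$ its derivative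
  is $\varrho\,\mathrm{Cov}(W,G)$.
\<close>

lemma covariance_left_lpp_le:
  assumes "0 < \<delta>"
  shows "expectation (\<lambda>x. left_sum n x * lpp x m n) - n / \<rho> * lpp_mean m n \<rho>
    \<le> ((\<integral>x. lpp x m n \<partial>lpp_env m n \<rho> (\<rho> / (1 + \<delta>))) - lpp_mean m n \<rho>) / (\<rho> * \<delta>)"
proof -
  define K where "K = expectation (\<lambda>x. left_sum n x * lpp x m n)"
  define D where "D = (\<integral>x. lpp x m n \<partial>lpp_env m n \<rho> (\<rho> / (1 + \<delta>))) - lpp_mean m n \<rho>"
  have le: "\<rho> / (1 + h) * K - n * lpp_mean m n \<rho> \<le> D / \<delta>" if h: "0 < h" "h \<le> \<delta>" for h
  proof -
    define u where "u = h / \<delta>"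
    have u: "0 \<le> u" "u \<le> 1" "u * \<delta> = h" using h assms by (auto simp: u_def)
    let ?s = "\<lambda>h x (p :: nat \<times> nat). (if fst p = 0 then 1 + h else 1) * (x p :: real)"
    have "(\<integral>x. lpp x m n \<partial>lpp_env m n \<rho> (\<rho> / (1 + h))) = expectation (\<lambda>x. lpp (?s h x) m n)"
      using h by (intro expectation_stretched_left(2)[symmetric]) auto
    also have "\<dots> \<le> expectation (\<lambda>x. (1 - u) * lpp x m n + u * lpp (?s \<delta> x) m n)"
    proof (rule integral_mono)
      show "integrable (lpp_env m n \<rho> \<rho>) (\<lambda>x. lpp (?s h x) m n)"
        using h by (intro expectation_stretched_left(1)) auto
      show "integrable (lpp_env m n \<rho> \<rho>) (\<lambda>x. (1 - u) * lpp x m n + u * lpp (?s \<delta> x) m n)"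
        using expectation_stretched_left(1)[of \<delta>] integrable_lpp(1)[of \<rho> \<rho> m n] assms \<rho> by simp
      fix x
      have "?s h x = (\<lambda>p. (1 - u) * x p + u * ?s \<delta> x p)"
        by (auto simp: fun_eq_iff u(3)[symmetric] algebra_simps)
      then show "lpp (?s h x) m n \<le> (1 - u) * lpp x m n + u * lpp (?s \<delta> x) m n"
        using lpp_convex[OF u(1,2), of x "?s \<delta> x" m n] by simp
    qed
    also have "\<dots> = (1 - u) * lpp_mean m n \<rho> + u * (\<integral>x. lpp x m n \<partial>lpp_env m n \<rho> (\<rho> / (1 + \<delta>)))"
      using expectation_stretched_left[of \<delta>] integrable_lpp(1)[of \<rho> \<rho> m n] assms \<rho> by (simp add: expectation_lpp)
    also have "\<dots> = lpp_mean m n \<rho> + u * D"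
      by (simp add: D_def algebra_simps)
    finally have "lpp_mean m n \<rho> + (\<rho> * h / (1 + h)) * K - n * h * lpp_mean m n \<rho> \<le> lpp_mean m n \<rho> + u * D"
      using expectation_slower_left_ge[of h] h unfolding K_def by linarith
    then have "h * (\<rho> / (1 + h) * K - n * lpp_mean m n \<rho>) \<le> h * (D / \<delta>)"
      by (simp add: u_def algebra_simps)
    then show ?thesis using h by (simp only: mult_le_cancel_left_pos)
  qed
  \<comment> \<open>Letting \<open>h\<close> tend to \<open>0\<close> turns the chord inequality into the bound on the derivative.\<close>
  have "((\<lambda>h. \<rho> / (1 + h) * K - n * lpp_mean m n \<rho>) \<longlongrightarrow> \<rho> / (1 + 0) * K - n * lpp_mean m n \<rho>) (at_right 0)"
    by (intro tendsto_intros) auto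
  moreover have "eventually (\<lambda>h. \<rho> / (1 + h) * K - n * lpp_mean m n \<rho> \<le> D / \<delta>) (at_right 0)"
    using eventually_at_right_less[of "0::real"] eventually_at_right[of 0 \<delta>] assms le
    by (auto simp: eventually_at_right intro!: exI[of _ \<delta>])
  ultimately have "\<rho> / (1 + 0) * K - n * lpp_mean m n \<rho> \<le> D / \<delta>"
    by (rule tendsto_upperbound) auto
  then have "\<rho> * (K - n / \<rho> * lpp_mean m n \<rho>) \<le> \<rho> * (D / (\<rho> * \<delta>))"
    using \<rho> by (simp add: algebra_simps)
  then show ?thesis
    using \<rho>(1) unfolding K_def D_def by (simp only: mult_le_cancel_left_pos)
qed

text \<open>
  The left rate is lowered to $\varrho - u$, that is, the left weights are stretched by a relative amount $\delta$ of
  order \<open>u\<close>. The resulting growth of the mean is read off from the exponential moment of order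
  \<open>u\<close>, since $u (G - \mu) \le e^{u(G-\mu)}$.
\<close>

lemma variance_lpp_le:
  assumes "0 < u" "\<rho> + u < 1" "2 * u < \<rho>"
  shows "variance (\<lambda>x. lpp x m n) \<le> m / (1 - \<rho>)\<^sup>2 - n / \<rho>\<^sup>2 +
    2 * (lpp_mgf m n \<rho> (\<rho> + u) + lpp_mgf m n (\<rho> - 2 * u) (\<rho> - u)) * exp (- u * lpp_mean m n \<rho>) / u\<^sup>2"
proof -
  define \<tau> where "\<tau> = \<rho> - u"
  define \<delta> where "\<delta> = u / \<tau>"
  define \<mu> where "\<mu> = lpp_mean m n \<rho>"
  define C where "C = lpp_mgf m n \<rho> (\<rho> + u) + lpp_mgf m n (\<rho> - 2 * u) (\<rho> - u)"
  have \<tau>: "0 < \<tau>" "\<tau> < 1" "u < \<tau>" using assms \<rho> by (auto simp: \<tau>_def)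
  have \<delta>: "0 < \<delta>" "\<rho> / (1 + \<delta>) = \<tau>" using \<tau> assms by (auto simp: \<delta>_def \<tau>_def field_simps)
  interpret T: prob_space "lpp_env m n \<rho> \<tau>" using \<rho> \<tau> by (intro prob_space_lpp_env)
  have i: "integrable (lpp_env m n \<rho> \<tau>) (\<lambda>x. lpp x m n)"
    using \<rho> \<tau> by (intro integrable_lpp)
  have e: "integrable (lpp_env m n \<rho> \<tau>) (\<lambda>x. exp (u * lpp x m n))"
    "T.expectation (\<lambda>x. exp (u * lpp x m n)) \<le> C"
    using integrable_exp_lpp[of \<rho> \<tau> u m n] \<rho> \<tau> assms by (auto simp: C_def \<tau>_def)
  have "u * (T.expectation (\<lambda>x. lpp x m n) - \<mu>) = T.expectation (\<lambda>x. u * (lpp x m n - \<mu>))"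
    using i by (simp add: T.prob_space algebra_simps)
  also have "\<dots> \<le> T.expectation (\<lambda>x. exp (- u * \<mu>) * exp (u * lpp x m n))"
  proof (rule integral_mono)
    show "u * (lpp x m n - \<mu>) \<le> exp (- u * \<mu>) * exp (u * lpp x m n)" for x
      using exp_ge_add_one_self[of "u * (lpp x m n - \<mu>)"] by (simp add: mult_exp_exp algebra_simps)
  qed (use i e in auto)
  also have "\<dots> \<le> exp (- u * \<mu>) * C"
    using e by simp
  finally have "T.expectation (\<lambda>x. lpp x m n) - \<mu> \<le> exp (- u * \<mu>) * C / u"
    using assms by (simp add: field_simps)
  then have "(T.expectation (\<lambda>x. lpp x m n) - \<mu>) / (\<rho> * \<delta>) \<le> exp (- u * \<mu>) * C / u / (\<rho> * \<delta>)"
    using \<rho> \<delta> by (intro divide_right_mono) auto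
  also have "\<dots> \<le> exp (- u * \<mu>) * C / u / u"
  proof (rule divide_left_mono)
    show "u \<le> \<rho> * \<delta>" using \<rho> \<tau> assms by (auto simp: \<delta>_def \<tau>_def field_simps)
    have "0 < C" unfolding C_def using assms \<rho> by (intro add_pos_pos lpp_mgf_pos) auto
    then show "0 \<le> exp (- u * \<mu>) * C / u" using assms by simp
  qed (use assms \<rho> \<delta> in auto)
  finally have 1: "(T.expectation (\<lambda>x. lpp x m n) - \<mu>) / (\<rho> * \<delta>) \<le> exp (- u * \<mu>) * C / u / u" .
  have 2: "expectation (\<lambda>x. left_sum n x * lpp x m n) - n / \<rho> * \<mu>
      \<le> (T.expectation (\<lambda>x. lpp x m n) - \<mu>) / (\<rho> * \<delta>)"
    using covariance_left_lpp_le[OF \<delta>(1)] by (simp only: \<mu>_def \<delta>(2))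
  have "v \<le> a + 2 * z" if "t \<le> z" "x \<le> t" "v = a + 2 * x" for v a z t x :: real
    using that by linarith
  from this[OF 1 2 variance_lpp[folded \<mu>_def]]
  have "variance (\<lambda>x. lpp x m n) \<le> m / (1 - \<rho>)\<^sup>2 - n / \<rho>\<^sup>2 + 2 * (exp (- u * \<mu>) * C / u / u)" .
  moreover have "2 * (exp (- u * \<mu>) * C / u / u) = 2 * C * exp (- u * \<mu>) / u\<^sup>2"
    by (simp add: power2_eq_square)
  ultimately show ?thesis unfolding C_def \<mu>_def by simp
qed

text \<open>
  With $Y = 2s(G-\mu)$, the hypothesis on \<open>1 + d\<close> and the monotone comparison give
  $d \le E(e^Y - 1) \le E(Y e^Y)$, and by the arithmetic-geometric mean inequality
  $Y e^Y \le \frac{k}{2} Y^2 + \frac{1}{2k} e^{2Y}$ for every $k > 0$. As $E\,e^{2Y} \le C$, the choice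
  $k = C/d$ makes the last term at most $d/2$.
\<close>

lemma variance_lpp_ge:
  assumes s: "0 < s" "4 * s < \<rho>" "\<rho> + 4 * s < 1"
    and d: "0 \<le> d" "1 + d \<le> lpp_mgf m n (\<rho> - s) (\<rho> + s) * exp (- (2 * s) * lpp_mean m n \<rho>)"
    and C: "(lpp_mgf m n \<rho> (\<rho> + 4 * s) + lpp_mgf m n (\<rho> - 4 * s) \<rho>) * exp (- (4 * s) * lpp_mean m n \<rho>) \<le> C" "0 < C"
  shows "d\<^sup>2 / (4 * C * s\<^sup>2) \<le> variance (\<lambda>x. lpp x m n)"
proof (cases "d = 0")
  case True
  then show ?thesis by simp
next
  case False
  with d have "0 < d" by simp
  define k where "k = C / d"
  have "0 < k" using \<open>0 < d\<close> C by (simp add: k_def)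
  define \<mu> where "\<mu> = lpp_mean m n \<rho>"
  let ?Y = "\<lambda>x. 2 * s * (lpp x m n - \<mu>)"
  have exp_Y: "exp (?Y x) = exp (- (2 * s) * \<mu>) * exp (2 * s * lpp x m n)"
    "exp (2 * ?Y x) = exp (- (4 * s) * \<mu>) * exp (4 * s * lpp x m n)" for x
    by (simp_all add: mult_exp_exp algebra_simps)
  have i1: "integrable (lpp_env m n \<rho> \<rho>) (\<lambda>x. exp (2 * s * lpp x m n))"
    using integrable_exp_lpp(1)[of \<rho> \<rho> "2 * s" m n] s \<rho> by simp
  have i2: "integrable (lpp_env m n \<rho> \<rho>) (\<lambda>x. exp (4 * s * lpp x m n))"
    and e2: "expectation (\<lambda>x. exp (4 * s * lpp x m n)) \<le> lpp_mgf m n \<rho> (\<rho> + 4 * s) + lpp_mgf m n (\<rho> - 4 * s) \<rho>"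
    using integrable_exp_lpp[of \<rho> \<rho> "4 * s" m n] s \<rho> by simp_all
  have iv: "integrable (lpp_env m n \<rho> \<rho>) (\<lambda>x. (lpp x m n - \<mu>)\<^sup>2)"
    using integrable_lpp[of \<rho> \<rho> m n] \<rho> by (simp add: power2_diff)
  have var: "variance (\<lambda>x. lpp x m n) = expectation (\<lambda>x. (lpp x m n - \<mu>)\<^sup>2)"
    by (simp add: expectation_lpp \<mu>_def)
  have "lpp_mgf m n (\<rho> - s) (\<rho> + s) \<le> expectation (\<lambda>x. exp (2 * s * lpp x m n))"
  proof -
    have "ennreal (lpp_mgf m n (\<rho> - s) (\<rho> + s)) \<le> (\<integral>\<^sup>+x. ennreal (exp (2 * s * lpp x m n)) \<partial>lpp_env m n \<rho> \<rho>)"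
      using nn_integral_exp_lpp_ge[of "\<rho> - s" \<rho> "\<rho> + s" m n] s \<rho> by simp
    also have "\<dots> = ennreal (expectation (\<lambda>x. exp (2 * s * lpp x m n)))"
      by (intro nn_integral_eq_integral i1) simp
    finally show ?thesis by (simp add: integral_nonneg_AE)
  qed
  then have "lpp_mgf m n (\<rho> - s) (\<rho> + s) * exp (- (2 * s) * \<mu>) \<le> expectation (\<lambda>x. exp (2 * s * lpp x m n)) * exp (- (2 * s) * \<mu>)"
    by (rule mult_right_mono) simp
  then have "1 + d \<le> expectation (\<lambda>x. exp (2 * s * lpp x m n)) * exp (- (2 * s) * \<mu>)"
    using d(2)[folded \<mu>_def] by (rule order_trans[rotated])
  also have "\<dots> = expectation (\<lambda>x. exp (?Y x))"
    unfolding exp_Y by (simp add: mult.commute)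
  finally have "d \<le> expectation (\<lambda>x. exp (?Y x) - 1)"
    using i1 unfolding exp_Y by (simp add: prob_space)
  also have "\<dots> \<le> expectation (\<lambda>x. k / 2 * (?Y x)\<^sup>2 + 1 / (2 * k) * exp (2 * ?Y x))"
  proof (rule integral_mono)
    show "integrable (lpp_env m n \<rho> \<rho>) (\<lambda>x. exp (?Y x) - 1)"
      using i1 unfolding exp_Y by simp
    show "integrable (lpp_env m n \<rho> \<rho>) (\<lambda>x. k / 2 * (?Y x)\<^sup>2 + 1 / (2 * k) * exp (2 * ?Y x))"
      using i2 iv unfolding exp_Y by (simp add: power_mult_distrib)
    have "exp y - 1 \<le> k / 2 * y\<^sup>2 + 1 / (2 * k) * exp (2 * y)" for y
    proof -
      have "1 - y \<le> exp (- y)" using exp_ge_add_one_self[of "- y"] by simp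
      then have "(1 - y) * exp y \<le> exp (- y) * exp y" by (rule mult_right_mono) simp
      then have "exp y - 1 \<le> y * exp y" by (simp add: mult_exp_exp algebra_simps)
      also have "\<dots> \<le> k / 2 * y\<^sup>2 + 1 / (2 * k) * (exp y)\<^sup>2"
      proof -
        have "0 \<le> (k * y - exp y)\<^sup>2 / (2 * k)" using \<open>0 < k\<close> by simp
        also have "\<dots> = ((k * y)\<^sup>2 + (exp y)\<^sup>2) / (2 * k) - y * exp y"
          using \<open>0 < k\<close> by (simp add: power2_diff diff_divide_distrib)
        also have "\<dots> = k / 2 * y\<^sup>2 + 1 / (2 * k) * (exp y)\<^sup>2 - y * exp y"
          using \<open>0 < k\<close> by (simp add: power2_eq_square add_divide_distrib)
        finally show ?thesis by simp
      qed
      finally show ?thesis by (simp only: exp_double)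
    qed
    then show "exp (?Y x) - 1 \<le> k / 2 * (?Y x)\<^sup>2 + 1 / (2 * k) * exp (2 * ?Y x)" for x .
  qed
  also have "\<dots> = k / 2 * (4 * s\<^sup>2 * variance (\<lambda>x. lpp x m n)) +
      1 / (2 * k) * (exp (- (4 * s) * \<mu>) * expectation (\<lambda>x. exp (4 * s * lpp x m n)))"
    using i2 iv unfolding exp_Y var by (simp add: power_mult_distrib)
  also have "\<dots> \<le> k / 2 * (4 * s\<^sup>2 * variance (\<lambda>x. lpp x m n)) + 1 / (2 * k) * C"
  proof (intro add_left_mono mult_left_mono)
    show "exp (- (4 * s) * \<mu>) * expectation (\<lambda>x. exp (4 * s * lpp x m n)) \<le> C"
      using order_trans[OF mult_right_mono[OF e2, of "exp (- (4 * s) * \<mu>)"] C(1)[folded \<mu>_def]]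
      by (simp only: mult.commute) simp
  qed (use \<open>0 < k\<close> in simp)
  also have "1 / (2 * k) * C = d / 2"
    using \<open>0 < C\<close> by (simp add: k_def)
  finally have "d / 2 \<le> k / 2 * (4 * s\<^sup>2 * variance (\<lambda>x. lpp x m n))"
    by simp
  also have "\<dots> = (4 * C * s\<^sup>2) * variance (\<lambda>x. lpp x m n) / (2 * d)"
    by (simp add: k_def)
  finally have "d\<^sup>2 \<le> (4 * C * s\<^sup>2) * variance (\<lambda>x. lpp x m n)"
    using \<open>0 < d\<close> by (simp add: power2_eq_square pos_le_divide_eq)
  moreover have "0 < 4 * C * s\<^sup>2" using \<open>0 < C\<close> s(1) by simp
  ultimately show ?thesis
    by (simp only: pos_divide_le_eq mult.commute)
qed

end

section \<open>The characteristic direction\<close>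

text \<open>
  The logarithm of the moment generating function at \<open>\<sigma>\<close> and \<open>\<tau>\<close> is a difference of values of this one function.
\<close>

definition log_mgf_primitive :: "nat \<Rightarrow> nat \<Rightarrow> real \<Rightarrow> real" where
  "log_mgf_primitive m n x = n * ln x - m * ln (1 - x)"

lemma lpp_mgf_eq_exp:
  assumes "0 < \<sigma>" "\<sigma> < 1" "0 < \<tau>" "\<tau> < 1"
  shows "lpp_mgf m n \<sigma> \<tau> = exp (log_mgf_primitive m n \<tau> - log_mgf_primitive m n \<sigma>)"
proof -
  have "exp (log_mgf_primitive m n \<tau> - log_mgf_primitive m n \<sigma>)
      = exp (n * (ln \<tau> - ln \<sigma>) + m * (ln (1 - \<sigma>) - ln (1 - \<tau>)))"
    by (simp add: log_mgf_primitive_def algebra_simps)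
  also have "\<dots> = exp (ln \<tau> - ln \<sigma>) ^ n * exp (ln (1 - \<sigma>) - ln (1 - \<tau>)) ^ m"
    by (simp only: exp_add exp_of_nat_mult)
  also have "\<dots> = lpp_mgf m n \<sigma> \<tau>"
    using assms by (simp add: exp_diff lpp_mgf_def)
  finally show ?thesis ..
qed

text \<open>
  Third order is the right order: the linear term is the mean of the last-passage time and the
  quadratic term has a bounded coefficient in the characteristic direction, which leaves the cubic
  term to set the scale $t^{-1/3}$.
\<close>

lemma log_mgf_primitive_taylor:
  assumes "0 < \<rho>" "\<rho> < 1" "0 < x" "x < 1"
  obtains \<xi> where "min x \<rho> \<le> \<xi>" "\<xi> \<le> max x \<rho>"
    "log_mgf_primitive m n x = log_mgf_primitive m n \<rho> + lpp_mean m n \<rho> * (x - \<rho>)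
      + (m / (1 - \<rho>)\<^sup>2 - n / \<rho>\<^sup>2) / 2 * (x - \<rho>)\<^sup>2
      + (n / \<xi> ^ 3 + m / (1 - \<xi>) ^ 3) / 3 * (x - \<rho>) ^ 3"
proof (cases "x = \<rho>")
  case True
  then show ?thesis using that[of \<rho>] by simp
next
  case False
  define D :: "nat \<Rightarrow> real \<Rightarrow> real" where "D k = (if k = 0 then log_mgf_primitive m n
    else if k = 1 then (\<lambda>y. n / y + m / (1 - y))
    else if k = 2 then (\<lambda>y. - n / y\<^sup>2 + m / (1 - y)\<^sup>2)
    else (\<lambda>y. 2 * n / y ^ 3 + 2 * m / (1 - y) ^ 3))" for k
  have "\<exists>t. (if x < \<rho> then x < t \<and> t < \<rho> else \<rho> < t \<and> t < x) \<and>
    log_mgf_primitive m n x = (\<Sum>k<3. D k \<rho> / fact k * (x - \<rho>) ^ k) + D 3 t / fact 3 * (x - \<rho>) ^ 3"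
  proof (rule Taylor[where a = "min x \<rho>" and b = "max x \<rho>"])
    show "\<forall>k t. k < 3 \<and> min x \<rho> \<le> t \<and> t \<le> max x \<rho> \<longrightarrow> DERIV (D k) t :> D (Suc k) t"
    proof (intro allI impI)
      fix k :: nat and t :: real assume kt: "k < 3 \<and> min x \<rho> \<le> t \<and> t \<le> max x \<rho>"
      then have t: "0 < t" "t < 1" using assms by auto
      from kt consider "k = 0" | "k = 1" | "k = 2" by linarith
      then show "DERIV (D k) t :> D (Suc k) t"
      proof cases
        case 1
        have "((\<lambda>y. n * ln y - m * ln (1 - y)) has_real_derivative (n / t + m / (1 - t))) (at t)"
          using t by (auto intro!: derivative_eq_intros simp: field_simps)
        then show ?thesis using 1 by (simp add: D_def log_mgf_primitive_def[abs_def])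
      next
        case 2
        have "((\<lambda>y. n / y + m / (1 - y)) has_real_derivative (- n / t\<^sup>2 + m / (1 - t)\<^sup>2)) (at t)"
          using t by (auto intro!: derivative_eq_intros simp: power2_eq_square)
        then show ?thesis using 2 by (simp add: D_def numeral_2_eq_2)
      next
        case 3
        have "((\<lambda>y. - n * inverse y ^ 2 + m * inverse (1 - y) ^ 2) has_real_derivative
            (2 * n * inverse t ^ 3 + 2 * m * inverse (1 - t) ^ 3)) (at t)"
          using t by (auto intro!: derivative_eq_intros simp: power2_eq_square power3_eq_cube)
        then show ?thesis using 3 by (simp add: D_def divide_inverse power_inverse)
      qed
    qed
  qed (use assms False in \<open>auto simp: D_def\<close>)
  then obtain t where t: "if x < \<rho> then x < t \<and> t < \<rho> else \<rho> < t \<and> t < x"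
    and eq: "log_mgf_primitive m n x = (\<Sum>k<3. D k \<rho> / fact k * (x - \<rho>) ^ k) + D 3 t / fact 3 * (x - \<rho>) ^ 3"
    by blast
  show ?thesis
  proof (rule that)
    show "min x \<rho> \<le> t" "t \<le> max x \<rho>" using t by (auto split: if_splits)
    have "(\<Sum>k<3. D k \<rho> / fact k * (x - \<rho>) ^ k) = log_mgf_primitive m n \<rho> + lpp_mean m n \<rho> * (x - \<rho>)
      + (m / (1 - \<rho>)\<^sup>2 - n / \<rho>\<^sup>2) / 2 * (x - \<rho>)\<^sup>2"
      by (simp add: D_def numeral_3_eq_3 lpp_mean_def power2_eq_square add.commute)
    moreover have "D 3 t / fact 3 = (n / t ^ 3 + m / (1 - t) ^ 3) / 3"
      by (simp add: D_def fact_numeral mult.commute)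
    ultimately show "log_mgf_primitive m n x = log_mgf_primitive m n \<rho> + lpp_mean m n \<rho> * (x - \<rho>)
      + (m / (1 - \<rho>)\<^sup>2 - n / \<rho>\<^sup>2) / 2 * (x - \<rho>)\<^sup>2
      + (n / t ^ 3 + m / (1 - t) ^ 3) / 3 * (x - \<rho>) ^ 3"
      using eq by (simp only:)
  qed
qed

context
  fixes \<rho> t :: real and m n :: nat
  assumes \<rho>: "0 < \<rho>" "\<rho> < 1"
    and m_def: "m = nat \<lfloor>(1 - \<rho>)\<^sup>2 * t\<rfloor>" and n_def: "n = nat \<lfloor>\<rho>\<^sup>2 * t\<rfloor>"
    and t: "8 \<le> t" "1 \<le> (1 - \<rho>)\<^sup>2 * t" "1 \<le> \<rho>\<^sup>2 * t"
begin

lemma mn_pos: "0 < m" "0 < n"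
  using t by (auto simp: m_def n_def)

lemma mn_bounds: "m \<le> (1 - \<rho>)\<^sup>2 * t" "(1 - \<rho>)\<^sup>2 * t - 1 \<le> m" "n \<le> \<rho>\<^sup>2 * t" "\<rho>\<^sup>2 * t - 1 \<le> n"
  using t unfolding m_def n_def by linarith+

text \<open>
  This is where the direction $((1-\varrho)^2, \varrho^2)$ enters: both fractions equal \<open>t\<close> up
  to the rounding of the endpoint.
\<close>

lemma curvature_bound: "\<bar>m / (1 - \<rho>)\<^sup>2 - n / \<rho>\<^sup>2\<bar> \<le> 1 / (1 - \<rho>)\<^sup>2 + 1 / \<rho>\<^sup>2"
proof -
  have aux: "k / q \<le> t" "t - 1 / q \<le> k / q" if "0 < q" "k \<le> q * t" "q * t - 1 \<le> k" for k q :: real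
    using that divide_right_mono[of "q * t - 1" k q] by (simp_all add: diff_divide_distrib pos_divide_le_eq mult.commute)
  have "m / (1 - \<rho>)\<^sup>2 \<le> t" "t - 1 / (1 - \<rho>)\<^sup>2 \<le> m / (1 - \<rho>)\<^sup>2"
    using mn_bounds \<rho> by (intro aux; simp)+
  moreover have "n / \<rho>\<^sup>2 \<le> t" "t - 1 / \<rho>\<^sup>2 \<le> n / \<rho>\<^sup>2"
    using mn_bounds \<rho> by (intro aux; simp)+
  moreover have "0 < 1 / \<rho>\<^sup>2" "0 < 1 / (1 - \<rho>)\<^sup>2" using \<rho> by auto
  ultimately show ?thesis unfolding abs_le_iff by linarith
qed

lemma size_bounds: "t / 4 \<le> real n + real m" "real n + real m \<le> t"
proof -
  have sq: "(1 - \<rho>)\<^sup>2 * t + \<rho>\<^sup>2 * t = t - 2 * (\<rho> * (1 - \<rho>)) * t"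
    by (simp add: power2_eq_square algebra_simps)
  have "\<rho> * (1 - \<rho>) \<le> 1 / 4"
    using zero_le_power2[of "\<rho> - 1 / 2"] by (simp add: power2_eq_square algebra_simps)
  then have "2 * (\<rho> * (1 - \<rho>)) * t \<le> 2 * (1 / 4) * t"
    using t by (intro mult_right_mono mult_left_mono) auto
  then show "t / 4 \<le> real n + real m"
    using mn_bounds sq t by linarith
  have "0 \<le> 2 * (\<rho> * (1 - \<rho>)) * t" using \<rho> t by auto
  then show "real n + real m \<le> t"
    using mn_bounds sq by linarith
qed

text \<open>
  What remains of the logarithmic moment generating function after centring at the mean.
\<close>

definition "mgf_excess x =
  log_mgf_primitive m n x - log_mgf_primitive m n \<rho> - lpp_mean m n \<rho> * (x - \<rho>)"

lemma lpp_mgf_centred: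
  assumes "0 < \<sigma>" "\<sigma> < 1" "0 < \<tau>" "\<tau> < 1" "u = \<tau> - \<sigma>"
  shows "lpp_mgf m n \<sigma> \<tau> * exp (- u * lpp_mean m n \<rho>) = exp (mgf_excess \<tau> - mgf_excess \<sigma>)"
  using assms(1-4) by (simp add: assms(5) lpp_mgf_eq_exp mult_exp_exp mgf_excess_def algebra_simps)

lemma mgf_excess_taylor:
  assumes "0 < x" "x < 1"
  obtains \<xi> where "min x \<rho> \<le> \<xi>" "\<xi> \<le> max x \<rho>"
    "mgf_excess x = (m / (1 - \<rho>)\<^sup>2 - n / \<rho>\<^sup>2) / 2 * (x - \<rho>)\<^sup>2
      + (n / \<xi> ^ 3 + m / (1 - \<xi>) ^ 3) / 3 * (x - \<rho>) ^ 3"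
proof -
  obtain \<xi> where "min x \<rho> \<le> \<xi>" "\<xi> \<le> max x \<rho>"
    "log_mgf_primitive m n x = log_mgf_primitive m n \<rho> + lpp_mean m n \<rho> * (x - \<rho>)
      + (m / (1 - \<rho>)\<^sup>2 - n / \<rho>\<^sup>2) / 2 * (x - \<rho>)\<^sup>2
      + (n / \<xi> ^ 3 + m / (1 - \<xi>) ^ 3) / 3 * (x - \<rho>) ^ 3"
    by (rule log_mgf_primitive_taylor[OF \<rho> assms])
  then show ?thesis by (intro that[of \<xi>]) (simp_all add: mgf_excess_def)
qed

lemma third_derivative_bounds:
  assumes "0 < c" "c \<le> \<xi>" "c \<le> 1 - \<xi>"
  shows "t / 4 \<le> n / \<xi> ^ 3 + m / (1 - \<xi>) ^ 3" "n / \<xi> ^ 3 + m / (1 - \<xi>) ^ 3 \<le> t / c ^ 3"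
proof -
  have c3: "c ^ 3 \<le> \<xi> ^ 3" "c ^ 3 \<le> (1 - \<xi>) ^ 3" using assms by (auto intro!: power_mono)
  have le1: "\<xi> ^ 3 \<le> 1" "(1 - \<xi>) ^ 3 \<le> 1" using assms by (auto intro!: power_le_one)
  have pos: "0 < \<xi> ^ 3" "0 < (1 - \<xi>) ^ 3" "0 < c ^ 3" using assms by auto
  have "n / \<xi> ^ 3 + m / (1 - \<xi>) ^ 3 \<le> n / c ^ 3 + m / c ^ 3"
    using c3 pos by (intro add_mono divide_left_mono) auto
  also have "\<dots> = (real n + real m) / c ^ 3" by (simp add: add_divide_distrib)
  also have "\<dots> \<le> t / c ^ 3" using size_bounds pos by (intro divide_right_mono) auto
  finally show "n / \<xi> ^ 3 + m / (1 - \<xi>) ^ 3 \<le> t / c ^ 3" .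
  have "real n / 1 + real m / 1 \<le> n / \<xi> ^ 3 + m / (1 - \<xi>) ^ 3"
    using le1 pos by (intro add_mono divide_left_mono) auto
  then show "t / 4 \<le> n / \<xi> ^ 3 + m / (1 - \<xi>) ^ 3" using size_bounds(1) by linarith
qed

text \<open>
  The distance $c$ keeps $x$ and the Taylor point away from $0$ and $1$, and at scale $t^{-1/3}$ the cubic
  term, with coefficient at most $t/(3c^3)$, contributes at most $1/3$.
\<close>

lemma mgf_excess_bounded:
  assumes c: "0 < c" "2 * c \<le> \<rho>" "2 * c \<le> 1 - \<rho>" and x: "\<bar>x - \<rho>\<bar> \<le> c / t powr (1 / 3)"
  shows "\<bar>mgf_excess x\<bar> \<le> (1 / (1 - \<rho>)\<^sup>2 + 1 / \<rho>\<^sup>2) / 2 * c\<^sup>2 + 1 / 3"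
proof -
  define w where "w = t powr (1 / 3)"
  have w: "1 \<le> w" "w ^ 3 = t"
    using t by (auto simp: w_def ge_one_powr_ge_zero powr_realpow[symmetric] powr_powr)
  have "c / w \<le> c / 1" using w c by (intro divide_left_mono) auto
  then have xc: "\<bar>x - \<rho>\<bar> \<le> c" using x by (simp add: w_def)
  then have "0 < x" "x < 1" using c by (auto simp: abs_le_iff)
  then obtain \<xi> where \<xi>: "min x \<rho> \<le> \<xi>" "\<xi> \<le> max x \<rho>"
    and eq: "mgf_excess x = (m / (1 - \<rho>)\<^sup>2 - n / \<rho>\<^sup>2) / 2 * (x - \<rho>)\<^sup>2
      + (n / \<xi> ^ 3 + m / (1 - \<xi>) ^ 3) / 3 * (x - \<rho>) ^ 3"
    by (rule mgf_excess_taylor)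
  have c\<xi>: "c \<le> \<xi>" "c \<le> 1 - \<xi>" using \<xi> xc c by (auto simp: abs_le_iff min_def max_def split: if_splits)
  note b = third_derivative_bounds[OF c(1) c\<xi>]
  have "0 \<le> n / \<xi> ^ 3 + m / (1 - \<xi>) ^ 3" using b(1) t(1) by linarith
  then have abs_b: "\<bar>n / \<xi> ^ 3 + m / (1 - \<xi>) ^ 3\<bar> \<le> t / c ^ 3" using b(2) by (simp only: abs_of_nonneg)
  have "\<bar>(m / (1 - \<rho>)\<^sup>2 - n / \<rho>\<^sup>2) / 2 * (x - \<rho>)\<^sup>2\<bar>
      = \<bar>m / (1 - \<rho>)\<^sup>2 - n / \<rho>\<^sup>2\<bar> / 2 * \<bar>x - \<rho>\<bar>\<^sup>2"
    by (simp add: abs_mult)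
  also have "\<dots> \<le> (1 / (1 - \<rho>)\<^sup>2 + 1 / \<rho>\<^sup>2) / 2 * c\<^sup>2"
    using curvature_bound xc by (intro mult_mono power_mono divide_right_mono) auto
  finally have 1: "\<bar>(m / (1 - \<rho>)\<^sup>2 - n / \<rho>\<^sup>2) / 2 * (x - \<rho>)\<^sup>2\<bar> \<le> (1 / (1 - \<rho>)\<^sup>2 + 1 / \<rho>\<^sup>2) / 2 * c\<^sup>2" .
  have "\<bar>(n / \<xi> ^ 3 + m / (1 - \<xi>) ^ 3) / 3 * (x - \<rho>) ^ 3\<bar>
      = \<bar>n / \<xi> ^ 3 + m / (1 - \<xi>) ^ 3\<bar> / 3 * \<bar>x - \<rho>\<bar> ^ 3"
    by (simp add: abs_mult power_abs)
  also have "\<dots> \<le> (t / c ^ 3) / 3 * (c / w) ^ 3"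
    using abs_b x t(1) c(1) by (intro mult_mono power_mono divide_right_mono) (simp_all add: w_def)
  also have "\<dots> = 1 / 3"
    using w c t by (simp add: power_divide)
  finally have 2: "\<bar>(n / \<xi> ^ 3 + m / (1 - \<xi>) ^ 3) / 3 * (x - \<rho>) ^ 3\<bar> \<le> 1 / 3" .
  show ?thesis unfolding eq by (rule order_trans[OF abs_triangle_ineq add_mono[OF 1 2]])
qed

text \<open>
  The quadratic terms cancel between \<open>\<rho> + s\<close> and \<open>\<rho> - s\<close>, whereas the cubic terms add up.
\<close>

lemma mgf_excess_increment:
  assumes "0 < s" "s < \<rho>" "s < 1 - \<rho>"
  shows "t * s ^ 3 / 6 \<le> mgf_excess (\<rho> + s) - mgf_excess (\<rho> - s)"
proof -
  have "0 < \<rho> + s" "\<rho> + s < 1" "0 < \<rho> - s" "\<rho> - s < 1" using assms \<rho> by auto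
  then obtain \<xi> \<eta> where \<xi>: "min (\<rho> + s) \<rho> \<le> \<xi>" "\<xi> \<le> max (\<rho> + s) \<rho>"
    and eq1: "mgf_excess (\<rho> + s) = (m / (1 - \<rho>)\<^sup>2 - n / \<rho>\<^sup>2) / 2 * ((\<rho> + s) - \<rho>)\<^sup>2
      + (n / \<xi> ^ 3 + m / (1 - \<xi>) ^ 3) / 3 * ((\<rho> + s) - \<rho>) ^ 3"
    and \<eta>: "min (\<rho> - s) \<rho> \<le> \<eta>" "\<eta> \<le> max (\<rho> - s) \<rho>"
    and eq2: "mgf_excess (\<rho> - s) = (m / (1 - \<rho>)\<^sup>2 - n / \<rho>\<^sup>2) / 2 * ((\<rho> - s) - \<rho>)\<^sup>2
      + (n / \<eta> ^ 3 + m / (1 - \<eta>) ^ 3) / 3 * ((\<rho> - s) - \<rho>) ^ 3"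
    by (metis mgf_excess_taylor)
  define c where "c = min (\<rho> - s) (1 - \<rho> - s)"
  have c: "0 < c" "c \<le> \<xi>" "c \<le> 1 - \<xi>" "c \<le> \<eta>" "c \<le> 1 - \<eta>"
    using \<xi> \<eta> assms by (auto simp: c_def)
  have "mgf_excess (\<rho> + s) - mgf_excess (\<rho> - s)
      = ((n / \<xi> ^ 3 + m / (1 - \<xi>) ^ 3) + (n / \<eta> ^ 3 + m / (1 - \<eta>) ^ 3)) / 3 * s ^ 3"
  proof -
    have "(p / 2 * ((\<rho> + s) - \<rho>)\<^sup>2 + A / 3 * ((\<rho> + s) - \<rho>) ^ 3)
        - (p / 2 * ((\<rho> - s) - \<rho>)\<^sup>2 + B / 3 * ((\<rho> - s) - \<rho>) ^ 3) = (A + B) / 3 * s ^ 3" for p A B :: real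
      by (simp add: power3_eq_cube algebra_simps)
    then show ?thesis unfolding eq1 eq2 .
  qed
  also have "\<dots> \<ge> (t / 4 + t / 4) / 3 * s ^ 3"
    using third_derivative_bounds(1)[OF c(1-3)] third_derivative_bounds(1)[OF c(1,4,5)] assms
    by (intro mult_right_mono divide_right_mono add_mono) auto
  finally show ?thesis by simp
qed

text \<open>
  All parameters in the two variance bounds lie within $c t^{-1/3}$ of $\varrho$, where every centred moment
  generating function is at most $e^{2K}$. The power $t^{2/3}$ is then the factor $1/s^2$ of those bounds.
\<close>

lemma variance_lpp_scaling:
  assumes c: "0 < c" "2 * c \<le> \<rho>" "2 * c \<le> 1 - \<rho>"
    and a: "a = 1 / (1 - \<rho>)\<^sup>2 + 1 / \<rho>\<^sup>2" and K: "K = a / 2 * c\<^sup>2 + 1 / 3"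
  defines "V \<equiv> prob_space.variance (lpp_env m n \<rho> \<rho>) (\<lambda>x. lpp x m n)"
  shows "(c ^ 3 / 384)\<^sup>2 * 2 / (exp (2 * K) * c\<^sup>2) * t powr (2 / 3) \<le> V"
    and "V \<le> (a + 64 * exp (2 * K) / c\<^sup>2) * t powr (2 / 3)"
proof -
  define w where "w = t powr (1 / 3)"
  have w: "1 \<le> w" "w ^ 3 = t" "w\<^sup>2 = t powr (2 / 3)"
    using t by (auto simp: w_def ge_one_powr_ge_zero powr_realpow[symmetric] powr_powr)
  \<comment> \<open>The lower bound uses exponential moments up to order \<open>4 * s\<close>, which must stay
    within \<open>c / w\<close> of \<open>\<rho>\<close>. The gain there is \<open>t * s ^ 3 / 6 = c ^ 3 / 384\<close>.\<close>
  define s where "s = c / 4 / w"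
  have s: "0 < s" "4 * s = c / w" using c w by (auto simp: s_def)
  have "c / w \<le> c / 1" using w c by (intro divide_left_mono) auto
  then have sc: "4 * s \<le> c" using s by simp
  have s3: "t * s ^ 3 = c ^ 3 / 64"
    using w t by (simp add: s_def power_divide)
  have s2: "1 / s\<^sup>2 = 16 / c\<^sup>2 * w\<^sup>2"
    by (simp add: s_def power_divide)
  have dom: "0 < \<rho> - 4 * s" "\<rho> + 4 * s < 1" using sc c \<rho> by auto
  have g: "\<bar>mgf_excess (\<rho> + h)\<bar> \<le> K" if "\<bar>h\<bar> \<le> 4 * s" for h
    using mgf_excess_bounded[OF c, of "\<rho> + h"] that s by (simp add: K a w_def)
  have mgf_le: "lpp_mgf m n (\<rho> + h) (\<rho> + h') * exp (- u * lpp_mean m n \<rho>) \<le> exp (2 * K)"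
    if "\<bar>h\<bar> \<le> 4 * s" "\<bar>h'\<bar> \<le> 4 * s" "u = h' - h" for h h' u
  proof -
    have "lpp_mgf m n (\<rho> + h) (\<rho> + h') * exp (- u * lpp_mean m n \<rho>)
        = exp (mgf_excess (\<rho> + h') - mgf_excess (\<rho> + h))"
      using that dom by (intro lpp_mgf_centred) auto
    also have "mgf_excess (\<rho> + h') - mgf_excess (\<rho> + h) \<le> 2 * K"
      using g[OF that(1)] g[OF that(2)] by linarith
    finally show ?thesis by simp
  qed
  show "(c ^ 3 / 384)\<^sup>2 * 2 / (exp (2 * K) * c\<^sup>2) * t powr (2 / 3) \<le> V"
  proof -
    have "(c ^ 3 / 384)\<^sup>2 / (4 * (2 * exp (2 * K)) * s\<^sup>2) \<le> V"
      unfolding V_def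
    proof (rule variance_lpp_ge[OF mn_pos \<rho> s(1)])
      show "4 * s < \<rho>" "\<rho> + 4 * s < 1" using dom by auto
      show "0 \<le> c ^ 3 / 384" using c by simp
      have "1 + c ^ 3 / 384 \<le> exp (c ^ 3 / 384)" by (rule exp_ge_add_one_self)
      also have "c ^ 3 / 384 \<le> mgf_excess (\<rho> + s) - mgf_excess (\<rho> - s)"
        using mgf_excess_increment[of s] s3 dom s \<rho> by simp
      then have "exp (c ^ 3 / 384) \<le> exp (mgf_excess (\<rho> + s) - mgf_excess (\<rho> - s))" by simp
      also have "\<dots> = lpp_mgf m n (\<rho> - s) (\<rho> + s) * exp (- (2 * s) * lpp_mean m n \<rho>)"
        using dom s by (intro lpp_mgf_centred[symmetric]) auto
      finally show "1 + c ^ 3 / 384 \<le> lpp_mgf m n (\<rho> - s) (\<rho> + s) * exp (- (2 * s) * lpp_mean m n \<rho>)" .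
      show "(lpp_mgf m n \<rho> (\<rho> + 4 * s) + lpp_mgf m n (\<rho> - 4 * s) \<rho>) * exp (- (4 * s) * lpp_mean m n \<rho>) \<le> 2 * exp (2 * K)"
        using mgf_le[of 0 "4 * s" "4 * s"] mgf_le[of "- (4 * s)" 0 "4 * s"] s(1) by (simp add: distrib_right)
    qed simp
    also have "(c ^ 3 / 384)\<^sup>2 / (4 * (2 * exp (2 * K)) * s\<^sup>2) = (c ^ 3 / 384)\<^sup>2 / (8 * exp (2 * K)) * (1 / s\<^sup>2)"
      by simp
    also have "\<dots> = (c ^ 3 / 384)\<^sup>2 * 2 / (exp (2 * K) * c\<^sup>2) * t powr (2 / 3)"
      unfolding s2 w(3) by simp
    finally show ?thesis .
  qed
  show "V \<le> (a + 64 * exp (2 * K) / c\<^sup>2) * t powr (2 / 3)"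
  proof -
    have "V \<le> m / (1 - \<rho>)\<^sup>2 - n / \<rho>\<^sup>2 +
      2 * (lpp_mgf m n \<rho> (\<rho> + s) + lpp_mgf m n (\<rho> - 2 * s) (\<rho> - s)) * exp (- s * lpp_mean m n \<rho>) / s\<^sup>2"
      unfolding V_def using dom s by (intro variance_lpp_le[OF mn_pos \<rho>]) auto
    also have "\<dots> = m / (1 - \<rho>)\<^sup>2 - n / \<rho>\<^sup>2 +
      2 * (lpp_mgf m n \<rho> (\<rho> + s) * exp (- s * lpp_mean m n \<rho>)
        + lpp_mgf m n (\<rho> - 2 * s) (\<rho> - s) * exp (- s * lpp_mean m n \<rho>)) * (1 / s\<^sup>2)"
      by (simp add: distrib_right)
    also have "\<dots> \<le> a + 2 * (exp (2 * K) + exp (2 * K)) * (1 / s\<^sup>2)"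
    proof (intro add_mono mult_right_mono mult_left_mono)
      show "m / (1 - \<rho>)\<^sup>2 - n / \<rho>\<^sup>2 \<le> a" using curvature_bound by (simp add: a)
      show "lpp_mgf m n \<rho> (\<rho> + s) * exp (- s * lpp_mean m n \<rho>) \<le> exp (2 * K)"
        using mgf_le[of 0 s s] s by simp
      show "lpp_mgf m n (\<rho> - 2 * s) (\<rho> - s) * exp (- s * lpp_mean m n \<rho>) \<le> exp (2 * K)"
        using mgf_le[of "- (2 * s)" "- s" s] s by simp
    qed auto
    also have "\<dots> = a + 64 * exp (2 * K) / c\<^sup>2 * w\<^sup>2"
      unfolding s2 by simp
    also have "\<dots> \<le> a * w\<^sup>2 + 64 * exp (2 * K) / c\<^sup>2 * w\<^sup>2"
    proof (rule add_right_mono)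
      have "1 \<le> w\<^sup>2" using w(1) by simp
      moreover have "0 \<le> a" by (simp add: a)
      ultimately show "a \<le> a * w\<^sup>2" using mult_left_mono[of 1 "w\<^sup>2" a] by simp
    qed
    finally show ?thesis unfolding w(3) by (simp add: distrib_right)
  qed
qed

end

text \<open>
  On the finite rectangle the weights have the product law \<open>lpp_env\<close>, and the weight at the origin
  vanishes almost surely.
\<close>

lemma variance_last_passage_at:
  fixes M :: "'a measure" and \<rho> :: real and \<omega> :: "nat \<times> nat \<Rightarrow> 'a \<Rightarrow> real"
  assumes "prob_space M"
    and \<rho>: "0 < \<rho>" "\<rho> < 1"
    and ind: "prob_space.indep_vars M (\<lambda>_. borel) \<omega> UNIV"
    and origin: "AE x in M. \<omega> (0, 0) x = 0"
    and hor: "\<And>i. 1 \<le> i \<Longrightarrow> distributed M lborel (\<omega> (i, 0)) (exponential_density (1 - \<rho>))"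
    and ver: "\<And>j. 1 \<le> j \<Longrightarrow> distributed M lborel (\<omega> (0, j)) (exponential_density \<rho>)"
    and bulk: "\<And>i j. 1 \<le> i \<Longrightarrow> 1 \<le> j \<Longrightarrow> distributed M lborel (\<omega> (i, j)) (exponential_density 1)"
    and m_def: "m = nat \<lfloor>(1 - \<rho>)\<^sup>2 * t\<rfloor>" and n_def: "n = nat \<lfloor>\<rho>\<^sup>2 * t\<rfloor>" and "0 < m"
  shows "prob_space.variance M (last_passage_at \<rho> \<omega> t) =
    prob_space.variance (lpp_env m n \<rho> \<rho>) (\<lambda>x. lpp x m n)"
proof -
  interpret prob_space M by fact
  let ?X = "\<lambda>x. \<lambda>p\<in>grid m n. \<omega> p x"
  have rv [measurable]: "\<omega> p \<in> borel_measurable M" for p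
    using ind unfolding indep_vars_def by blast
  have X [measurable]: "?X \<in> measurable M (PiM (grid m n) (\<lambda>_. borel))" by measurable
  have marginal: "distr M borel (\<omega> p) = expo (rates \<rho> \<rho> p)" if "p \<in> grid m n" for p
  proof -
    obtain i j where p: "p = (i, j)" by (cases p)
    have "distributed M lborel (\<omega> p) (exponential_density (rates \<rho> \<rho> p))"
      using that hor[of i] ver[of j] bulk[of i j] by (auto simp: p grid_iff rates_def)
    then have "distr M lborel (\<omega> p) = expo (rates \<rho> \<rho> p)"
      by (simp add: distributed_def expo_def)
    moreover have "distr M lborel (\<omega> p) = distr M borel (\<omega> p)" by (intro distr_cong) auto
    ultimately show ?thesis by simp
  qed
  have "(1, 0) \<in> grid m n" using \<open>0 < m\<close> by (simp add: grid_iff)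
  moreover have "indep_vars (\<lambda>_. borel) \<omega> (grid m n)"
    by (rule indep_vars_subset[OF ind]) simp
  ultimately have "distr M (PiM (grid m n) (\<lambda>_. borel)) ?X = PiM (grid m n) (\<lambda>p. distr M borel (\<omega> p))"
    by (subst indep_vars_iff_distr_eq_PiM'[symmetric]) auto
  also have "\<dots> = lpp_env m n \<rho> \<rho>"
    unfolding lpp_env_def expo_env_def using marginal by (intro PiM_cong) auto
  finally have d: "distr M (PiM (grid m n) (\<lambda>_. borel)) ?X = lpp_env m n \<rho> \<rho>" .
  have lp: "last_passage_at \<rho> \<omega> t x = \<omega> (0, 0) x + lpp (?X x) m n" for x
  proof -
    have "lpp (\<lambda>p. \<omega> p x) m n = lpp (?X x) m n" by (intro lpp_cong) auto
    then show ?thesis by (simp add: last_passage_at_def m_def n_def last_passage_eq_lpp)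
  qed
  have [measurable]: "(\<lambda>x. lpp (?X x) m n) \<in> borel_measurable M"
    by (rule measurable_compose[OF X measurable_lpp])
  have [measurable]: "last_passage_at \<rho> \<omega> t \<in> borel_measurable M"
    unfolding lp[abs_def] by measurable
  have AE: "AE x in M. last_passage_at \<rho> \<omega> t x = lpp (?X x) m n"
    using origin by eventually_elim (simp add: lp)
  have transfer: "(\<integral>x. g (last_passage_at \<rho> \<omega> t x) \<partial>M) = (\<integral>x. g (lpp x m n) \<partial>lpp_env m n \<rho> \<rho>)"
    if [measurable]: "g \<in> borel_measurable borel" for g :: "real \<Rightarrow> real"
  proof -
    have "(\<integral>x. g (last_passage_at \<rho> \<omega> t x) \<partial>M) = (\<integral>x. g (lpp (?X x) m n) \<partial>M)"
      using AE by (intro integral_cong_AE) (measurable, auto)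
    also have "\<dots> = (\<integral>x. g (lpp x m n) \<partial>lpp_env m n \<rho> \<rho>)"
      unfolding d[symmetric] by (rule integral_distr[symmetric, OF X]) measurable
    finally show ?thesis .
  qed
  show ?thesis
    using transfer[of "\<lambda>y. y"] transfer[of "\<lambda>y. (y - (\<integral>x. lpp x m n \<partial>lpp_env m n \<rho> \<rho>))\<^sup>2"] by simp
qed

theorem theorem2p1:
  fixes M :: "'a measure" and \<rho> :: real and \<omega> :: "nat \<times> nat \<Rightarrow> 'a \<Rightarrow> real"
  assumes "prob_space M"
    and "0 < \<rho>" and "\<rho> < 1"
    and "prob_space.indep_vars M (\<lambda>_. borel) \<omega> UNIV"
    and "AE x in M. \<omega> (0, 0) x = 0"
    and "\<And>i. 1 \<le> i \<Longrightarrow> distributed M lborel (\<omega> (i, 0)) (exponential_density (1 - \<rho>))"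
    and "\<And>j. 1 \<le> j \<Longrightarrow> distributed M lborel (\<omega> (0, j)) (exponential_density \<rho>)"
    and "\<And>i j. 1 \<le> i \<Longrightarrow> 1 \<le> j \<Longrightarrow> distributed M lborel (\<omega> (i, j)) (exponential_density 1)"
  shows "0 < Liminf at_top (\<lambda>t::real. ereal (prob_space.variance M (last_passage_at \<rho> \<omega> t) / t powr (2 / 3)))
    \<and> Liminf at_top (\<lambda>t::real. ereal (prob_space.variance M (last_passage_at \<rho> \<omega> t) / t powr (2 / 3)))
        \<le> Limsup at_top (\<lambda>t::real. ereal (prob_space.variance M (last_passage_at \<rho> \<omega> t) / t powr (2 / 3)))
    \<and> Limsup at_top (\<lambda>t::real. ereal (prob_space.variance M (last_passage_at \<rho> \<omega> t) / t powr (2 / 3))) < \<infinity>"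
proof -
  let ?f = "\<lambda>t::real. prob_space.variance M (last_passage_at \<rho> \<omega> t) / t powr (2 / 3)"
  define c where "c = min \<rho> (1 - \<rho>) / 2"
  have c: "0 < c" "2 * c \<le> \<rho>" "2 * c \<le> 1 - \<rho>" using assms(2,3) by (auto simp: c_def)
  define a where "a = 1 / (1 - \<rho>)\<^sup>2 + 1 / \<rho>\<^sup>2"
  define K where "K = a / 2 * c\<^sup>2 + 1 / 3"
  define C1 where "C1 = (c ^ 3 / 384)\<^sup>2 * 2 / (exp (2 * K) * c\<^sup>2)"
  define C2 where "C2 = a + 64 * exp (2 * K) / c\<^sup>2"
  have "0 < C1" using c by (simp add: C1_def)
  have ev: "\<forall>\<^sub>F t in at_top. C1 \<le> ?f t \<and> ?f t \<le> C2"
    using eventually_ge_at_top[of "8::real"] eventually_ge_at_top[of "1 / (1 - \<rho>)\<^sup>2"] eventually_ge_at_top[of "1 / \<rho>\<^sup>2"]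
  proof eventually_elim
    case (elim t)
    define m where "m = nat \<lfloor>(1 - \<rho>)\<^sup>2 * t\<rfloor>"
    define n where "n = nat \<lfloor>\<rho>\<^sup>2 * t\<rfloor>"
    have t: "8 \<le> t" "1 \<le> (1 - \<rho>)\<^sup>2 * t" "1 \<le> \<rho>\<^sup>2 * t"
      using elim assms(2,3) by (auto simp: field_simps)
    have "0 < m" using t by (simp add: m_def)
    have V: "prob_space.variance M (last_passage_at \<rho> \<omega> t) = prob_space.variance (lpp_env m n \<rho> \<rho>) (\<lambda>x. lpp x m n)"
      by (rule variance_last_passage_at[OF assms(1-5) _ _ _ m_def n_def \<open>0 < m\<close>]) (rule assms; assumption)+
    note B = variance_lpp_scaling[OF assms(2,3) m_def n_def t c a_def K_def, folded V C1_def C2_def]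
    have "0 < t powr (2 / 3)" using t by simp
    with B show ?case by (simp add: pos_le_divide_eq pos_divide_le_eq)
  qed
  have "ereal C1 \<le> Liminf at_top (\<lambda>t. ereal (?f t))"
    using ev by (intro Liminf_bounded) (auto elim: eventually_mono)
  moreover have "Limsup at_top (\<lambda>t. ereal (?f t)) \<le> ereal C2"
    using ev by (intro Limsup_bounded) (auto elim: eventually_mono)
  moreover have "Liminf at_top (\<lambda>t. ereal (?f t)) \<le> Limsup at_top (\<lambda>t. ereal (?f t))"
    by (intro Liminf_le_Limsup) simp
  ultimately show ?thesis
    using \<open>0 < C1\<close> by (auto intro: less_le_trans[of 0 "ereal C1"] le_less_trans[of _ "ereal C2"])
qed

end
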